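(* Let $1<p<\infty$. For a closed subspace $\mathcal{M}\subseteq L^p(0,1)$, the following are equivalent. (a) $C_p\mathcal{M}\subseteq\mathcal{M}$; (b) $S_t\mathcal{M}\subseteq\mathcal{M}$ for all $t\ge 0$.
   Context: $L^p(0,1)$ is the space of complex-valued $p$-integrable functions on $(0,1)$ with Lebesgue measure. $C_p$ is the bounded operator on $L^p(0,1)$ given by $(C_pf)(x)=\frac1x\int_0^x\frac{f(t)}{1-t}\,dt$, $0<x<1$. For $t\ge0$, $\phi_t(x)=\frac{e^{-t}x}{(e^{-t}-1)x+1}$ for $0\le x\le 1$, and $S_t$ is the bounded weighted composition operator on $L^p(0,1)$ given by $(S_tf)(x)=\frac{\phi_t(x)}{x}f(\phi_t(x))$, $0<x<1$. *)

theory Defs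
  imports "HOL-Analysis.Analysis"
begin

section \<open>Almost-everywhere classes of measurable functions on (0,1)\<close>

abbreviation unit_leb :: "real measure" where
  "unit_leb \<equiv> lebesgue_on {0<..<1}"

definition ae_rel :: "(real \<Rightarrow> complex) \<Rightarrow> (real \<Rightarrow> complex) \<Rightarrow> bool" where
  "ae_rel f g \<longleftrightarrow>
     f \<in> borel_measurable unit_leb \<and> g \<in> borel_measurable unit_leb \<and> (AE x in unit_leb. f x = g x)"

lemma part_equivp_ae_rel: "part_equivp ae_rel"
proof (rule part_equivpI)
  show "\<exists>f. ae_rel f f"
    by (rule exI[of _ "\<lambda>x. 0"]) (simp add: ae_rel_def)
  show "symp ae_rel"
    by (auto simp: symp_def ae_rel_def elim: AE_mp)
  show "transp ae_rel"
    unfolding transp_def ae_rel_def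
  proof (intro allI impI conjI; (elim conjE)?)
    fix f g h :: "real \<Rightarrow> complex"
    assume "AE x in unit_leb. f x = g x" "AE x in unit_leb. g x = h x"
    then show "AE x in unit_leb. f x = h x"
      by eventually_elim simp
  qed auto
qed

text \<open>All \<open>L\<^sup>p(0,1)\<close> are subsets of this one space of classes, so that \<open>p\<close> can be a variable.\<close>

quotient_type lfun = "real \<Rightarrow> complex" / partial: ae_rel
  by (rule part_equivp_ae_rel)

instantiation lfun :: ab_group_add
begin

lift_definition zero_lfun :: lfun is "\<lambda>x. 0"
  by (simp add: ae_rel_def)

lift_definition plus_lfun :: "lfun \<Rightarrow> lfun \<Rightarrow> lfun" is "\<lambda>f g x. f x + g x"
  unfolding ae_rel_def by (auto elim: AE_mp)

lift_definition uminus_lfun :: "lfun \<Rightarrow> lfun" is "\<lambda>f x. - f x"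
  unfolding ae_rel_def by (auto elim: AE_mp)

lift_definition minus_lfun :: "lfun \<Rightarrow> lfun \<Rightarrow> lfun" is "\<lambda>f g x. f x - g x"
  unfolding ae_rel_def by (auto elim: AE_mp)

instance
  by standard (transfer; simp add: ae_rel_def algebra_simps)+

end

lift_definition scale_lfun :: "complex \<Rightarrow> lfun \<Rightarrow> lfun" is "\<lambda>c f x. c * f x"
  unfolding ae_rel_def by (auto elim: AE_mp)

interpretation lfun: vector_space scale_lfun
  by standard (transfer; simp add: ae_rel_def algebra_simps)+


section \<open>The spaces \<open>L\<^sup>p(0,1)\<close>\<close>

lift_definition p_integrable :: "real \<Rightarrow> lfun \<Rightarrow> bool" is
  "\<lambda>p f. integrable unit_leb (\<lambda>x. norm (f x) powr p)"
proof -
  fix p :: real and f g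
  assume "ae_rel f g"
  then show "integrable unit_leb (\<lambda>x. norm (f x) powr p)
      = integrable unit_leb (\<lambda>x. norm (g x) powr p)"
    unfolding ae_rel_def by (intro integrable_cong_AE) (auto elim: AE_mp)
qed

definition Lp :: "real \<Rightarrow> lfun set" where
  "Lp p = {F. p_integrable p F}"

lift_definition Lp_norm :: "real \<Rightarrow> lfun \<Rightarrow> real" is
  "\<lambda>p f. (LINT x|unit_leb. norm (f x) powr p) powr (1 / p)"
proof -
  fix p :: real and f g
  assume "ae_rel f g"
  then have "(LINT x|unit_leb. norm (f x) powr p) = (LINT x|unit_leb. norm (g x) powr p)"
    unfolding ae_rel_def by (intro integral_cong_AE) (auto elim: AE_mp)
  then show "(LINT x|unit_leb. norm (f x) powr p) powr (1 / p)
      = (LINT x|unit_leb. norm (g x) powr p) powr (1 / p)"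
    by simp
qed

definition Lp_dist :: "real \<Rightarrow> lfun \<Rightarrow> lfun \<Rightarrow> real" where
  "Lp_dist p F G = Lp_norm p (F - G)"

abbreviation Lp_topology :: "real \<Rightarrow> lfun topology" where
  "Lp_topology p \<equiv> Metric_space.mtopology (Lp p) (Lp_dist p)"


section \<open>The operators\<close>

definition phi :: "real \<Rightarrow> real \<Rightarrow> real" where
  "phi t x = exp (- t) * x / ((exp (- t) - 1) * x + 1)"

lemma phi_denom_pos:
  fixes t x :: real
  assumes "x \<in> {0<..<1}" shows "0 < (exp (- t) - 1) * x + 1"
proof -
  have "(exp (- t) - 1) * x + 1 = exp (- t) * x + (1 - x)" by (simp add: algebra_simps)
  moreover have "0 < exp (- t) * x" "0 < 1 - x" using assms by auto
  ultimately show ?thesis by linarith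
qed

lemma phi_in:
  assumes "x \<in> {0<..<1}" shows "phi t x \<in> {0<..<1}"
proof -
  have "exp (- t) * x < (exp (- t) - 1) * x + 1" using assms by (simp add: algebra_simps)
  then show ?thesis
    using phi_denom_pos[OF assms, of t] assms by (simp add: phi_def)
qed

lemma phi_inverse:
  assumes "x \<in> {0<..<1}" shows "phi (- t) (phi t x) = x"
proof -
  define a where "a = exp (- t)"
  define d where "d = (a - 1) * x + 1"
  have a: "a > 0" "exp t = inverse a" by (auto simp: a_def exp_minus)
  have d: "d > 0" using phi_denom_pos[OF assms, of t] by (simp add: d_def a_def)
  have p: "phi t x = a * x / d" by (simp add: phi_def a_def d_def)
  have "(inverse a - 1) * (a * x / d) + 1 = 1 / d"
    using a d by (simp add: field_simps) (simp add: d_def algebra_simps)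
  moreover have "phi (- t) y = inverse a * y / ((inverse a - 1) * y + 1)" for y
    by (simp add: phi_def a(2))
  ultimately show ?thesis
    using a(1) d by (simp add: p)
qed

lemma phi_differentiable_on: "phi t differentiable_on {0<..<1}"
  unfolding differentiable_on_def
proof
  fix x :: real assume x: "x \<in> {0<..<1}"
  have "(\<lambda>x. exp (- t) * x / ((exp (- t) - 1) * x + 1)) differentiable at x within {0<..<1}"
    using phi_denom_pos[OF x, of t] by (intro derivative_intros) auto
  then show "phi t differentiable at x within {0<..<1}"
    by (simp add: phi_def[abs_def])
qed

lemma phi_vimage:
  assumes "A \<subseteq> {0<..<1}"
  shows "phi t -` A \<inter> {0<..<1} = phi (- t) ` A"
proof (intro equalityI subsetI)
  fix x assume "x \<in> phi t -` A \<inter> {0<..<1}"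
  then show "x \<in> phi (- t) ` A"
    using phi_inverse[of x t] by (metis IntE image_eqI vimageE)
next
  fix x assume "x \<in> phi (- t) ` A"
  then obtain y where y: "y \<in> A" "x = phi (- t) y" by auto
  then show "x \<in> phi t -` A \<inter> {0<..<1}"
    using assms phi_inverse[of y "- t"] phi_in[of y "- t"] by auto
qed

lemma phi_measurable: "phi t \<in> measurable unit_leb unit_leb"
proof (rule measurableI)
  fix A assume "A \<in> sets unit_leb"
  then have A: "A \<in> sets lebesgue" "A \<subseteq> {0<..<1}"
    by (auto simp: sets_restrict_space_iff)
  have "phi (- t) ` A \<in> sets lebesgue"
    using A by (intro differentiable_image_in_sets_lebesgue)
      (auto intro: differentiable_on_subset[OF phi_differentiable_on])
  moreover have "phi (- t) ` A \<subseteq> {0<..<1}" using A phi_in by blast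
  ultimately show "phi t -` A \<inter> space unit_leb \<in> sets unit_leb"
    using A by (simp add: phi_vimage sets_restrict_space_iff)
qed (use phi_in in auto)

lemma AE_phi:
  assumes "AE x in unit_leb. P x"
  shows "AE x in unit_leb. P (phi t x)"
proof -
  from assms obtain N where N: "{x \<in> space unit_leb. \<not> P x} \<subseteq> N" "emeasure unit_leb N = 0" "N \<in> sets unit_leb"
    by (rule AE_E)
  have N1: "N \<subseteq> {0<..<1}" "N \<in> sets lebesgue"
    using N(3) by (auto simp: sets_restrict_space_iff)
  have "emeasure lebesgue N = 0"
    using N(2) N1 by (simp add: emeasure_restrict_space)
  then have "negligible N" using N1 by (simp add: negligible_iff_null_sets null_sets_def)
  moreover have "phi (- t) differentiable_on N"
    using differentiable_on_subset[OF phi_differentiable_on N1(1)] .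
  ultimately have neg: "negligible (phi (- t) ` N)"
    by (intro negligible_differentiable_image_negligible) auto
  have sub: "phi (- t) ` N \<subseteq> {0<..<1}" using N1 phi_in by blast
  have "phi (- t) ` N \<in> null_sets unit_leb"
    using neg sub by (simp add: null_sets_restrict_space negligible_iff_null_sets)
  moreover have "{x \<in> space unit_leb. \<not> P (phi t x)} \<subseteq> phi (- t) ` N"
    using N(1) phi_in unfolding phi_vimage[OF N1(1), symmetric] by auto
  ultimately show ?thesis by (rule AE_I')
qed

text \<open>
  The two operators act on all classes; on a class outside \<open>L\<^sup>p(0,1)\<close> the integral below may be
  the default value 0, but only the restrictions to \<open>L\<^sup>p(0,1)\<close> with \<open>p > 1\<close> matter, where
  \<open>f t / (1 - t)\<close> is integrable on \<open>(0,x)\<close> for every \<open>x < 1\<close>.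
\<close>

lift_definition C_op :: "lfun \<Rightarrow> lfun" is
  "\<lambda>f x. complex_of_real (1 / x) *
     (LINT t|lebesgue_on {0<..<x}. f t / complex_of_real (1 - t))"
proof -
  have eq: "(LINT t|lebesgue_on {0<..<x}. f t / complex_of_real (1 - t))
      = (LINT t|unit_leb. (if t < x then f t / complex_of_real (1 - t) else 0))"
    if "x \<in> {0<..<1}" for f x
  proof -
    have "indicator {0<..<x} t *\<^sub>R (f t / complex_of_real (1 - t))
      = indicator {0<..<1} t *\<^sub>R (if t < x then f t / complex_of_real (1 - t) else 0)" for t
      using that by (auto simp: indicator_def)
    then show ?thesis
      by (simp add: integral_restrict_space)
  qed
  interpret finite_measure unit_leb
    by (rule finite_measureI) (simp add: emeasure_restrict_space)
  have meas: "(\<lambda>x. complex_of_real (1 / x) *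
     (LINT t|lebesgue_on {0<..<x}. f t / complex_of_real (1 - t))) \<in> borel_measurable unit_leb"
    if [measurable]: "f \<in> borel_measurable unit_leb" for f :: "real \<Rightarrow> complex"
  proof -
    have [measurable]: "(\<lambda>x. x) \<in> borel_measurable unit_leb"
      by (simp add: borel_measurable_if_I measurable_restrict_space1 measurable_completion)
    have "(\<lambda>x. complex_of_real (1 / x) *
        (LINT t|unit_leb. (if t < x then f t / complex_of_real (1 - t) else 0))) \<in> borel_measurable unit_leb"
      by measurable
    then show ?thesis
      by (rule measurable_cong[THEN iffD1, rotated]) (simp only: space_lebesgue_on eq)
  qed
  fix f g assume fg: "ae_rel f g"
  then have m: "f \<in> borel_measurable unit_leb" "g \<in> borel_measurable unit_leb"
    and ae: "AE x in unit_leb. f x = g x" by (auto simp: ae_rel_def)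
  have "(LINT t|lebesgue_on {0<..<x}. f t / complex_of_real (1 - t))
      = (LINT t|lebesgue_on {0<..<x}. g t / complex_of_real (1 - t))" if x: "x \<in> {0<..<1}" for x
  proof -
    have [measurable]: "(\<lambda>x. x) \<in> borel_measurable unit_leb"
      by (simp add: borel_measurable_if_I measurable_restrict_space1 measurable_completion)
    note [measurable] = m
    show ?thesis
      unfolding eq[OF x] by (intro integral_cong_AE) (measurable, use ae in \<open>auto elim: AE_mp\<close>)
  qed
  then show "ae_rel (\<lambda>x. complex_of_real (1 / x) *
     (LINT t|lebesgue_on {0<..<x}. f t / complex_of_real (1 - t)))
     (\<lambda>x. complex_of_real (1 / x) *
     (LINT t|lebesgue_on {0<..<x}. g t / complex_of_real (1 - t)))"
    using meas[OF m(1)] meas[OF m(2)] by (auto simp: ae_rel_def intro!: AE_I2)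
qed

lift_definition S_op :: "real \<Rightarrow> lfun \<Rightarrow> lfun" is
  "\<lambda>t f x. complex_of_real (phi t x / x) * f (phi t x)"
proof -
  fix t :: real and f g assume "ae_rel f g"
  then have m[measurable]: "f \<in> borel_measurable unit_leb" "g \<in> borel_measurable unit_leb"
    and ae: "AE x in unit_leb. f x = g x" by (auto simp: ae_rel_def)
  have [measurable]: "(\<lambda>x. x) \<in> borel_measurable unit_leb"
    by (simp add: borel_measurable_if_I measurable_restrict_space1 measurable_completion)
  note [measurable] = phi_measurable
  have [measurable]: "phi t \<in> borel_measurable unit_leb"
    unfolding phi_def[abs_def] by measurable
  show "ae_rel (\<lambda>x. complex_of_real (phi t x / x) * f (phi t x))
      (\<lambda>x. complex_of_real (phi t x / x) * g (phi t x))"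
    unfolding ae_rel_def
  proof (intro conjI)
    show "AE x in unit_leb. complex_of_real (phi t x / x) * f (phi t x)
        = complex_of_real (phi t x / x) * g (phi t x)"
      using AE_phi[OF ae, of t] by eventually_elim simp
  qed measurable
qed


section \<open>\<open>L\<^sup>p(0,1)\<close> is a subspace and a metric space\<close>

lemma powr_convex_nonneg:
  fixes p :: real
  assumes p: "1 \<le> p" and x: "0 \<le> x" "0 \<le> y" and u: "0 \<le> u" "0 \<le> v" "u + v = 1"
  shows "(u * x + v * y) powr p \<le> u * x powr p + v * y powr p"
proof -
  have scal: "(c * z) powr p \<le> c * z powr p" if "0 \<le> c" "c \<le> 1" "0 \<le> z" for c z
  proof (cases "c = 0")
    case False
    have "c powr p \<le> c powr 1" using p that False by (intro powr_mono') auto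
    then show ?thesis using that by (simp add: powr_mult mult_right_mono)
  qed (use p in auto)
  consider "x = 0" | "y = 0" | "x > 0" "y > 0" using x by linarith
  then show ?thesis
  proof cases
    case 1 then show ?thesis using scal[of v y] u x p by simp
  next
    case 2 then show ?thesis using scal[of u x] u x p by simp
  next
    case 3
    have "v = 1 - u" "u \<le> 1" using u by auto
    then show ?thesis
      using convex_onD[OF powr_convex[OF p], of v x y] 3 u by (simp add: \<open>v = 1 - u\<close>)
  qed
qed

lemma integrable_norm_powr_add:
  fixes f g :: "real \<Rightarrow> complex"
  assumes p: "1 \<le> p" and m[measurable]: "f \<in> borel_measurable M" "g \<in> borel_measurable M"
    and i: "integrable M (\<lambda>x. norm (f x) powr p)" "integrable M (\<lambda>x. norm (g x) powr p)"
  shows "integrable M (\<lambda>x. norm (f x + g x) powr p)"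
proof (rule Bochner_Integration.integrable_bound)
  show "integrable M (\<lambda>x. 2 powr p * (norm (f x) powr p + norm (g x) powr p))"
    using i by simp
  have "norm (f x + g x) powr p \<le> 2 powr p * (norm (f x) powr p + norm (g x) powr p)" for x
  proof -
    have "norm (f x + g x) powr p \<le> (2 * ((1/2) * norm (f x) + (1/2) * norm (g x))) powr p"
      using p by (intro powr_mono2) (auto intro: norm_triangle_ineq)
    also have "\<dots> = 2 powr p * ((1/2) * norm (f x) + (1/2) * norm (g x)) powr p"
      by (subst powr_mult) auto
    also have "\<dots> \<le> 2 powr p * ((1/2) * norm (f x) powr p + (1/2) * norm (g x) powr p)"
      by (intro mult_left_mono powr_convex_nonneg p) auto
    also have "\<dots> \<le> 2 powr p * (norm (f x) powr p + norm (g x) powr p)"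
      by (intro mult_left_mono add_mono mult_left_le_one_le) auto
    finally show ?thesis .
  qed
  then show "AE x in M. norm (norm (f x + g x) powr p)
      \<le> norm (2 powr p * (norm (f x) powr p + norm (g x) powr p))"
    by (intro AE_I2) simp
qed measurable

lemma Minkowski:
  fixes f g :: "real \<Rightarrow> complex"
  assumes p: "1 \<le> p" and m[measurable]: "f \<in> borel_measurable M" "g \<in> borel_measurable M"
    and i: "integrable M (\<lambda>x. norm (f x) powr p)" "integrable M (\<lambda>x. norm (g x) powr p)"
  shows "(LINT x|M. norm (f x + g x) powr p) powr (1 / p)
    \<le> (LINT x|M. norm (f x) powr p) powr (1 / p) + (LINT x|M. norm (g x) powr p) powr (1 / p)"
proof -
  define a where "a = (LINT x|M. norm (f x) powr p) powr (1 / p)"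
  define b where "b = (LINT x|M. norm (g x) powr p) powr (1 / p)"
  have ap: "a powr p = (LINT x|M. norm (f x) powr p)" and bp: "b powr p = (LINT x|M. norm (g x) powr p)"
    using p by (auto simp: a_def b_def powr_powr)
  have "0 \<le> a" "0 \<le> b" by (auto simp: a_def b_def)
  have null: "AE x in M. h x = 0"
    if "integrable M (\<lambda>x. norm (h x) powr p)" "(LINT x|M. norm (h x) powr p) powr (1 / p) = 0"
    for h :: "real \<Rightarrow> complex"
    using that p by (subst (asm) powr_eq_0_iff, subst (asm) integral_nonneg_eq_0_iff_AE) auto
  consider "a = 0" | "b = 0" | "a > 0" "b > 0" using \<open>0 \<le> a\<close> \<open>0 \<le> b\<close> by linarith
  then have "(LINT x|M. norm (f x + g x) powr p) powr (1 / p) \<le> a + b"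
  proof cases
    case 1
    then have "AE x in M. f x = 0" using null[OF i(1)] by (simp add: a_def)
    then have "(LINT x|M. norm (f x + g x) powr p) = (LINT x|M. norm (g x) powr p)"
      by (intro integral_cong_AE) (auto elim: AE_mp)
    then show ?thesis using 1 by (simp add: b_def)
  next
    case 2
    then have "AE x in M. g x = 0" using null[OF i(2)] by (simp add: b_def)
    then have "(LINT x|M. norm (f x + g x) powr p) = (LINT x|M. norm (f x) powr p)"
      by (intro integral_cong_AE) (auto elim: AE_mp)
    then show ?thesis using 2 by (simp add: a_def)
  next
    case 3
    define s where "s = a + b"
    have s: "s > 0" using 3 by (simp add: s_def)
    define K where "K x = s powr p * ((a / s) * (norm (f x) powr p / a powr p)
      + (b / s) * (norm (g x) powr p / b powr p))" for x
    have le: "norm (f x + g x) powr p \<le> K x" for x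
    proof -
      have "norm (f x + g x) \<le> s * ((a / s) * (norm (f x) / a) + (b / s) * (norm (g x) / b))"
        using 3 s by (simp add: distrib_left norm_triangle_ineq)
      then have "norm (f x + g x) powr p
          \<le> (s * ((a / s) * (norm (f x) / a) + (b / s) * (norm (g x) / b))) powr p"
        using p by (intro powr_mono2) auto
      also have "\<dots> = s powr p * ((a / s) * (norm (f x) / a) + (b / s) * (norm (g x) / b)) powr p"
        using s 3 by (subst powr_mult) auto
      also have "\<dots> \<le> s powr p * ((a / s) * (norm (f x) / a) powr p + (b / s) * (norm (g x) / b) powr p)"
        using s 3 by (intro mult_left_mono powr_convex_nonneg p) (auto simp: s_def add_divide_distrib[symmetric])
      also have "\<dots> = K x" using 3 by (simp add: K_def powr_divide)
      finally show ?thesis .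
    qed
    have "(LINT x|M. norm (f x + g x) powr p) \<le> (LINT x|M. K x)"
      using i by (intro integral_mono integrable_norm_powr_add p m le) (auto simp: K_def)
    also have "\<dots> = s powr p * ((a / s) * (a powr p / a powr p) + (b / s) * (b powr p / b powr p))"
      using i unfolding K_def by (simp add: ap bp)
    also have "\<dots> = s powr p"
      using 3 s by (simp add: s_def add_divide_distrib[symmetric])
    finally have "(LINT x|M. norm (f x + g x) powr p) powr (1 / p) \<le> (s powr p) powr (1 / p)"
      using p by (intro powr_mono2) auto
    also have "\<dots> = s" using s p by (simp add: powr_powr)
    finally show ?thesis by (simp add: s_def)
  qed
  then show ?thesis by (simp add: a_def b_def)
qed

lemma Lp_add: "1 \<le> p \<Longrightarrow> F \<in> Lp p \<Longrightarrow> G \<in> Lp p \<Longrightarrow> F + G \<in> Lp p"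
  unfolding Lp_def mem_Collect_eq
  by transfer (auto simp: ae_rel_def intro: integrable_norm_powr_add)

lemma Lp_scale: "F \<in> Lp p \<Longrightarrow> scale_lfun c F \<in> Lp p"
  unfolding Lp_def mem_Collect_eq
  by transfer (auto simp: norm_mult powr_mult)

lemma Lp_zero: "0 \<in> Lp p"
  unfolding Lp_def mem_Collect_eq by transfer simp

lemma subspace_Lp: "1 \<le> p \<Longrightarrow> lfun.subspace (Lp p)"
  by (auto simp: lfun.subspace_def Lp_add Lp_scale Lp_zero)

lemma Lp_norm_triangle:
  "1 \<le> p \<Longrightarrow> F \<in> Lp p \<Longrightarrow> G \<in> Lp p \<Longrightarrow> Lp_norm p (F + G) \<le> Lp_norm p F + Lp_norm p G"
  unfolding Lp_def mem_Collect_eq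
  by transfer (auto simp: ae_rel_def intro: Minkowski)

lemma Lp_norm_eq_0: "F \<in> Lp p \<Longrightarrow> Lp_norm p F = 0 \<longleftrightarrow> F = 0"
  unfolding Lp_def mem_Collect_eq
proof transfer
  fix p :: real and f :: "real \<Rightarrow> complex"
  assume "ae_rel f f" and i: "integrable unit_leb (\<lambda>x. norm (f x) powr p)"
  have "((LINT x|unit_leb. norm (f x) powr p) powr (1 / p) = 0)
      \<longleftrightarrow> (AE x in unit_leb. f x = 0)"
    using i by (subst powr_eq_0_iff, subst integral_nonneg_eq_0_iff_AE) auto
  with \<open>ae_rel f f\<close> show "((LINT x|unit_leb. norm (f x) powr p) powr (1 / p) = 0) = ae_rel f (\<lambda>x. 0)"
    by (simp add: ae_rel_def)
qed

lemma Lp_norm_nonneg: "0 \<le> Lp_norm p F"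
  by transfer simp

lemma Lp_norm_minus_commute: "Lp_norm p (F - G) = Lp_norm p (G - F)"
  by transfer (simp add: norm_minus_commute)

lemma Metric_space_Lp:
  assumes "1 \<le> p" shows "Metric_space (Lp p) (Lp_dist p)"
proof
  fix F G H assume FGH: "F \<in> Lp p" "G \<in> Lp p" "H \<in> Lp p"
  have "Lp_norm p ((F - G) + (G - H)) \<le> Lp_norm p (F - G) + Lp_norm p (G - H)"
    using FGH assms by (intro Lp_norm_triangle lfun.subspace_diff subspace_Lp)
  then show "Lp_dist p F H \<le> Lp_dist p F G + Lp_dist p G H"
    by (simp add: Lp_dist_def)
next
  fix F G assume "F \<in> Lp p" "G \<in> Lp p"
  then have "F - G \<in> Lp p" using assms by (intro lfun.subspace_diff subspace_Lp)
  then show "Lp_dist p F G = 0 \<longleftrightarrow> F = G"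
    by (simp add: Lp_dist_def Lp_norm_eq_0)
qed (auto simp: Lp_dist_def Lp_norm_nonneg Lp_norm_minus_commute)

end

theory Submission
  imports Defs
begin

text \<open>
  The operators \<open>S\<^sub>t\<close> form a strongly continuous semigroup on \<open>L\<^sup>p(0,1)\<close>, because
  \<open>\<phi>\<^sub>t\<close> is the flow that multiplies \<open>x / (1 - x)\<close> by \<open>e\<^sup>-\<^sup>t\<close>, and their norms decay
  exponentially. The substitution \<open>s = \<phi>\<^sub>t(x)\<close> turns the integral defining \<open>C\<^sub>p f\<close> into
  \<open>\<integral> S\<^sub>t f dt\<close> over \<open>(0,\<infinity>)\<close>. Thus, if \<open>\<Gamma>\<close> denotes the generator, \<open>C\<^sub>p\<close> is the resolvent
  \<open>R(0) = (0 - \<Gamma>)\<^sup>-\<^sup>1\<close>, and the theorem is an instance of a fact about exponentially decaying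
  semigroups: a closed subspace is invariant under \<open>R(0)\<close> iff it is invariant under the semigroup.

  From the semigroup to the resolvent: \<open>R(0) f - S\<^sub>T R(0) f = \<integral> S\<^sub>t f dt\<close> over \<open>(0,T)\<close> is a limit of
  Riemann sums, and \<open>S\<^sub>T R(0) f\<close> tends to 0 as \<open>T\<close> grows
  (\<open>R_invariant_if_S_invariant\<close>).

  From the resolvent to the semigroup: since \<open>R(l)\<close> has norm at most \<open>1 / (l + w)\<close>, where \<open>w\<close> is the
  decay rate, the resolvent identity expands \<open>R(m)\<close> in powers of \<open>R(l)\<close> as soon as
  \<open>\<bar>l - m\<bar> < l + w\<close>, and steps of length \<open>w / 2\<close> carry the invariance from \<open>0\<close> to every
  \<open>m \<ge> 0\<close> (\<open>R_invariant\<close>). Then \<open>(l R(l))\<^sup>n\<close> with \<open>l = n / t\<close>, the implicit Euler scheme, converges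
  to \<open>S\<^sub>t\<close> on the range of \<open>R(0)\<^sup>2\<close> (\<open>S_R_R_in_M\<close>), and difference quotients in \<open>t\<close> remove the two
  factors \<open>R(0)\<close> again (\<open>S_in_M_from_R\<close>).

  The equivalence is proved for an abstract decaying semigroup given together with its resolvents, which
  enter only through the derivative of \<open>h \<mapsto> S\<^sub>h R(l) f\<close> at \<open>0\<close>. For \<open>L\<^sup>p(0,1)\<close> the resolvents are the
  Laplace transforms of the orbits. Three estimates carry the verification: the decay of \<open>S\<^sub>t\<close>, by a
  change of variables (\<open>pmass_wcomp_le\<close>); strong continuity, by approximation with bounded continuous
  functions (\<open>strongly_continuous\<close>); and a form of Minkowski's integral inequality
  (\<open>pmass_integral_le\<close>), which bounds the Laplace transforms and shows that \<open>\<integral> e\<^sup>-\<^sup>l\<^sup>t S\<^sub>t f dt\<close> over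
  \<open>(0,h)\<close> differs from \<open>h f\<close> by \<open>o(h)\<close> (\<open>lap_generator\<close>).
\<close>

section \<open>Decaying semigroups given with their resolvents\<close>

text \<open>
  The space is a subspace \<open>X\<close> with a functional \<open>N\<close>, not a normed type, because \<open>L\<^sup>p(0,1)\<close> has to vary
  with \<open>p\<close> inside one type of classes. The last assumption says that \<open>(l - \<Gamma>) G = F\<close> has a solution,
  where \<open>\<Gamma>\<close> is the generator: it expresses \<open>-\<Gamma> G = F - l G\<close> as a one-sided derivative.
\<close>

locale resolvent_semigroup = vector_space scale
  for scale :: "complex \<Rightarrow> 'a::ab_group_add \<Rightarrow> 'a" +
  fixes X :: "'a set" and N :: "'a \<Rightarrow> real" and S :: "real \<Rightarrow> 'a \<Rightarrow> 'a" and w :: real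
  assumes subspace_X: "subspace X"
    and N_triangle: "F \<in> X \<Longrightarrow> G \<in> X \<Longrightarrow> N (F + G) \<le> N F + N G"
    and N_scale: "N (scale c F) = norm c * N F"
    and N_nonneg: "0 \<le> N F"
    and N_eq_0: "F \<in> X \<Longrightarrow> N F = 0 \<Longrightarrow> F = 0"
    and S_plus: "S t (F + G) = S t F + S t G"
    and S_scale: "S t (scale c F) = scale c (S t F)"
    and S_zero_time: "S 0 F = F"
    and S_semigroup: "0 \<le> s \<Longrightarrow> 0 \<le> t \<Longrightarrow> S s (S t F) = S (s + t) F"
    and S_in: "0 \<le> t \<Longrightarrow> F \<in> X \<Longrightarrow> S t F \<in> X"
    and w_pos: "0 < w"
    and S_decay: "0 \<le> t \<Longrightarrow> F \<in> X \<Longrightarrow> N (S t F) \<le> exp (- w * t) * N F"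
    and resolvent_exists: "0 \<le> l \<Longrightarrow> F \<in> X \<Longrightarrow> \<exists>G\<in>X.
      ((\<lambda>h. N (G - S h G - scale (of_real h) (F - scale (of_real l) G)) / h) \<longlongrightarrow> 0) (at_right 0)"
begin

abbreviation rscale :: "real \<Rightarrow> 'a \<Rightarrow> 'a" (infixr "\<cdot>" 75) where
  "r \<cdot> F \<equiv> scale (of_real r) F"

text \<open>
  \<open>g\<close> lies in the domain of the generator \<open>\<Gamma>\<close>, and \<open>-\<Gamma> g = f\<close>.
\<close>

definition neg_gen :: "'a \<Rightarrow> 'a \<Rightarrow> bool" where
  "neg_gen g f \<longleftrightarrow> ((\<lambda>h. N (g - S h g - h \<cdot> f) / h) \<longlongrightarrow> 0) (at_right 0)"

lemmas X_add = subspace_add[OF subspace_X] and X_diff = subspace_diff[OF subspace_X]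
  and X_scale = subspace_scale[OF subspace_X] and X_0 = subspace_0[OF subspace_X]
  and X_sum = subspace_sum[OF subspace_X]

lemmas X_closed = X_add X_diff X_scale X_0 S_in

lemma N_rscale: "N (r \<cdot> F) = \<bar>r\<bar> * N F"
  by (simp add: N_scale)

lemma N_0: "N 0 = 0"
  using N_scale[of 0 0] by simp

lemma N_minus: "N (- F) = N F"
  using N_scale[of "-1" F] by simp

lemma N_commute: "N (F - G) = N (G - F)"
  using N_minus[of "F - G"] by simp

lemma N_diff_triangle: "F \<in> X \<Longrightarrow> G \<in> X \<Longrightarrow> H \<in> X \<Longrightarrow> N (F - H) \<le> N (F - G) + N (G - H)"
  using N_triangle[of "F - G" "G - H"] by (simp add: X_diff)

lemma N_sum: "finite I \<Longrightarrow> (\<And>i. i \<in> I \<Longrightarrow> F i \<in> X) \<Longrightarrow> N (sum F I) \<le> (\<Sum>i\<in>I. N (F i))"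
proof (induction I rule: finite_induct)
  case empty then show ?case by (simp add: N_0)
next
  case (insert a I)
  have "N (F a + sum F I) \<le> N (F a) + N (sum F I)"
    using insert by (intro N_triangle X_sum) auto
  then show ?case using insert by simp
qed

lemma S_diff: "S t (F - G) = S t F - S t G"
  using S_plus[of t "F - G" G] by (simp add: algebra_simps)

lemma S_commute: "0 \<le> s \<Longrightarrow> 0 \<le> t \<Longrightarrow> S s (S t F) = S t (S s F)"
  by (simp add: S_semigroup add.commute)

lemma S_contraction:
  assumes "0 \<le> t" "F \<in> X" shows "N (S t F) \<le> N F"
proof -
  have "exp (- w * t) \<le> 1" using assms w_pos by simp
  then have "exp (- w * t) * N F \<le> 1 * N F" by (intro mult_right_mono N_nonneg)
  with S_decay[OF assms] show ?thesis by simp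
qed

lemma neg_gen_add:
  assumes "neg_gen g f" "neg_gen g' f'" "g \<in> X" "f \<in> X" "g' \<in> X" "f' \<in> X"
  shows "neg_gen (g + g') (f + f')"
  unfolding neg_gen_def
proof (rule tendsto_sandwich[OF _ _ tendsto_const])
  show "((\<lambda>h. N (g - S h g - h \<cdot> f) / h + N (g' - S h g' - h \<cdot> f') / h) \<longlongrightarrow> 0) (at_right 0)"
    using tendsto_add[OF assms(1,2)[unfolded neg_gen_def]] by simp
  show "\<forall>\<^sub>F h in at_right 0. N (g + g' - S h (g + g') - h \<cdot> (f + f')) / h
      \<le> N (g - S h g - h \<cdot> f) / h + N (g' - S h g' - h \<cdot> f') / h"
    using eventually_at_right_less[of 0]
  proof eventually_elim
    case (elim h)
    have eq: "g + g' - S h (g + g') - h \<cdot> (f + f') = (g - S h g - h \<cdot> f) + (g' - S h g' - h \<cdot> f')"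
      by (simp add: S_plus scale_right_distrib algebra_simps)
    have "N (g + g' - S h (g + g') - h \<cdot> (f + f')) \<le> N (g - S h g - h \<cdot> f) + N (g' - S h g' - h \<cdot> f')"
      unfolding eq using assms elim by (intro N_triangle X_closed) auto
    then show ?case using elim by (simp add: divide_right_mono flip: add_divide_distrib)
  qed
  show "\<forall>\<^sub>F h in at_right 0. 0 \<le> N (g + g' - S h (g + g') - h \<cdot> (f + f')) / h"
    using eventually_at_right_less[of 0] by eventually_elim (simp add: N_nonneg)
qed

lemma neg_gen_scale:
  assumes "neg_gen g f" shows "neg_gen (scale c g) (scale c f)"
proof -
  have "N (scale c g - S h (scale c g) - h \<cdot> scale c f) / h = norm c * (N (g - S h g - h \<cdot> f) / h)" for h
  proof -
    have "scale c g - S h (scale c g) - h \<cdot> scale c f = scale c (g - S h g - h \<cdot> f)"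
      by (simp add: S_scale scale_right_diff_distrib mult.commute)
    then show ?thesis by (simp add: N_scale)
  qed
  then show ?thesis
    unfolding neg_gen_def by (simp only: tendsto_mult_right_zero[OF assms[unfolded neg_gen_def]])
qed

lemma neg_gen_diff:
  assumes "neg_gen g f" "neg_gen g' f'" "g \<in> X" "f \<in> X" "g' \<in> X" "f' \<in> X"
  shows "neg_gen (g - g') (f - f')"
  using neg_gen_add[OF assms(1) neg_gen_scale[OF assms(2), of "-1"] assms(3,4)] assms
  by (simp add: subspace_neg[OF subspace_X])

lemma neg_gen_S:
  assumes "neg_gen g f" "0 \<le> t" "g \<in> X" "f \<in> X"
  shows "neg_gen (S t g) (S t f)"
  unfolding neg_gen_def
proof (rule tendsto_sandwich[OF _ _ tendsto_const])
  show "((\<lambda>h. N (g - S h g - h \<cdot> f) / h) \<longlongrightarrow> 0) (at_right 0)"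
    using assms(1) by (simp add: neg_gen_def)
  show "\<forall>\<^sub>F h in at_right 0. N (S t g - S h (S t g) - h \<cdot> S t f) / h \<le> N (g - S h g - h \<cdot> f) / h"
    using eventually_at_right_less[of 0]
  proof eventually_elim
    case (elim h)
    have "S t g - S h (S t g) - h \<cdot> S t f = S t (g - S h g - h \<cdot> f)"
      using elim assms by (simp add: S_diff S_scale S_commute)
    then have "N (S t g - S h (S t g) - h \<cdot> S t f) \<le> N (g - S h g - h \<cdot> f)"
      using assms elim by (auto intro!: S_contraction X_closed)
    then show ?case using elim by (simp add: divide_right_mono)
  qed
  show "\<forall>\<^sub>F h in at_right 0. 0 \<le> N (S t g - S h (S t g) - h \<cdot> S t f) / h"
    using eventually_at_right_less[of 0] by eventually_elim (simp add: N_nonneg)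
qed

text \<open>
  The hypothesis is \<open>(l - \<Gamma>) g = f\<close>, so \<open>(1 + h l) g = S\<^sub>h g + h f + o(h)\<close>. Taking norms, using the decay
  of \<open>S\<^sub>h\<close>, and dividing by \<open>h\<close> gives the bound in the limit. With \<open>f = 0\<close> it makes \<open>l - \<Gamma>\<close> injective.
\<close>

lemma resolvent_bound:
  assumes gen: "neg_gen g (f - l \<cdot> g)" and "0 \<le> l" "g \<in> X" "f \<in> X"
  shows "(l + w) * N g \<le> N f"
proof -
  define d where "d h = N (g - S h g - h \<cdot> (f - l \<cdot> g))" for h
  have d: "((\<lambda>h. d h / h) \<longlongrightarrow> 0) (at_right 0)"
    using gen by (simp add: neg_gen_def d_def)
  have "((\<lambda>h. exp (- w * h)) has_real_derivative - w) (at 0 within {0<..})"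
    by (auto intro!: derivative_eq_intros)
  then have e: "((\<lambda>h. (exp (- w * h) - 1) / h) \<longlongrightarrow> - w) (at_right 0)"
    by (simp add: has_field_derivative_iff)
  have "(l - (- w)) * N g \<le> N f + 0"
  proof (rule tendsto_le)
    show "((\<lambda>h. (l - (exp (- w * h) - 1) / h) * N g) \<longlongrightarrow> (l - (- w)) * N g) (at_right 0)"
      by (intro tendsto_intros e)
    show "((\<lambda>h. N f + d h / h) \<longlongrightarrow> N f + 0) (at_right 0)"
      by (intro tendsto_intros d)
    show "\<forall>\<^sub>F h in at_right 0. (l - (exp (- w * h) - 1) / h) * N g \<le> N f + d h / h"
      using eventually_at_right_less[of 0]
    proof eventually_elim
      case (elim h)
      have "(1 + h * l) * N g = N ((1 + h * l) \<cdot> g)"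
        using elim assms by (simp only: N_rscale) simp
      also have "(1 + h * l) \<cdot> g = (S h g + h \<cdot> f) + (g - S h g - h \<cdot> (f - l \<cdot> g))"
        by (simp add: scale_left_distrib scale_right_diff_distrib)
      also have "N \<dots> \<le> (N (S h g) + N (h \<cdot> f)) + d h"
        unfolding d_def using assms elim
        by (intro order_trans[OF N_triangle] add_mono order_refl N_triangle X_closed) auto
      also have "\<dots> \<le> (exp (- w * h) * N g + h * N f) + d h"
        using S_decay[of h g] elim assms by (simp add: N_rscale)
      finally have "(h * l - (exp (- w * h) - 1)) * N g \<le> h * N f + d h"
        by (simp add: algebra_simps)
      then have "(h * l - (exp (- w * h) - 1)) * N g / h \<le> (h * N f + d h) / h"
        using elim by (intro divide_right_mono) auto
      then show ?case using elim by (simp add: diff_divide_distrib add_divide_distrib algebra_simps)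
    qed
  qed simp
  then show ?thesis by simp
qed

lemma neg_gen_unique:
  assumes "neg_gen g (f - l \<cdot> g)" "neg_gen g' (f - l \<cdot> g')" "0 \<le> l" "g \<in> X" "g' \<in> X" "f \<in> X"
  shows "g = g'"
proof -
  have "neg_gen (g - g') ((f - l \<cdot> g) - (f - l \<cdot> g'))"
    using assms by (intro neg_gen_diff X_closed) auto
  then have "neg_gen (g - g') (0 - l \<cdot> (g - g'))"
    by (simp add: scale_right_diff_distrib)
  then have "(l + w) * N (g - g') \<le> N 0"
    using assms by (intro resolvent_bound X_closed) auto
  then have "N (g - g') = 0"
    using w_pos assms(3) N_nonneg[of "g - g'"] by (simp add: N_0 mult_le_0_iff)
  with N_eq_0[of "g - g'"] assms show ?thesis by (simp add: X_diff)
qed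

text \<open>
  The resolvent \<open>(l - \<Gamma>)\<^sup>-\<^sup>1\<close>. Its algebraic properties all follow from uniqueness of the solution
  (\<open>neg_gen_unique\<close>): it suffices to exhibit the right candidate.
\<close>

definition R :: "real \<Rightarrow> 'a \<Rightarrow> 'a" where
  "R l F = (SOME G. G \<in> X \<and> neg_gen G (F - l \<cdot> G))"

lemma R:
  assumes "0 \<le> l" "F \<in> X"
  shows R_in: "R l F \<in> X" and neg_gen_R: "neg_gen (R l F) (F - l \<cdot> R l F)"
proof -
  have "\<exists>G. G \<in> X \<and> neg_gen G (F - l \<cdot> G)"
    using resolvent_exists[OF assms] by (auto simp: neg_gen_def)
  from someI_ex[OF this] show "R l F \<in> X" "neg_gen (R l F) (F - l \<cdot> R l F)"
    by (auto simp: R_def)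
qed

lemma R_eqI: "neg_gen G (F - l \<cdot> G) \<Longrightarrow> 0 \<le> l \<Longrightarrow> F \<in> X \<Longrightarrow> G \<in> X \<Longrightarrow> R l F = G"
  using neg_gen_unique[OF neg_gen_R] R_in by blast

lemma R_bound: "0 \<le> l \<Longrightarrow> F \<in> X \<Longrightarrow> (l + w) * N (R l F) \<le> N F"
  by (intro resolvent_bound neg_gen_R R_in)

lemma R_diff:
  assumes "0 \<le> l" "F \<in> X" "G \<in> X" shows "R l (F - G) = R l F - R l G"
proof (rule R_eqI)
  have "neg_gen (R l F - R l G) ((F - l \<cdot> R l F) - (G - l \<cdot> R l G))"
    using assms by (intro neg_gen_diff neg_gen_R R_in X_closed)
  then show "neg_gen (R l F - R l G) (F - G - l \<cdot> (R l F - R l G))"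
    by (simp add: scale_right_diff_distrib algebra_simps)
qed (use assms in \<open>auto intro: X_closed R_in\<close>)

lemma R_scale:
  assumes "0 \<le> l" "F \<in> X" shows "R l (scale c F) = scale c (R l F)"
proof (rule R_eqI)
  show "neg_gen (scale c (R l F)) (scale c F - l \<cdot> scale c (R l F))"
    using neg_gen_scale[OF neg_gen_R[OF assms], of c] by (simp add: scale_right_diff_distrib mult.commute)
qed (use assms in \<open>auto intro: X_closed R_in\<close>)

lemma R_S:
  assumes "0 \<le> l" "0 \<le> t" "F \<in> X" shows "R l (S t F) = S t (R l F)"
proof (rule R_eqI)
  show "neg_gen (S t (R l F)) (S t F - l \<cdot> S t (R l F))"
    using neg_gen_S[OF neg_gen_R[OF assms(1,3)] assms(2)] assms
    by (simp add: S_diff S_scale R_in X_closed)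
qed (use assms in \<open>auto intro: X_closed R_in\<close>)

text \<open>
  Both sides solve \<open>(l - \<Gamma>) G = F + (l - m) R m F\<close>. In this form the identity is a fixed-point equation
  for \<open>R m F\<close> that involves only the operator \<open>R l\<close>.
\<close>

lemma resolvent_identity:
  assumes "0 \<le> l" "0 \<le> m" "F \<in> X"
  shows "R m F = R l (F + (l - m) \<cdot> R m F)"
proof (rule R_eqI[symmetric])
  show "neg_gen (R m F) (F + (l - m) \<cdot> R m F - l \<cdot> R m F)"
    using neg_gen_R[OF assms(2,3)] by (simp add: scale_left_diff_distrib)
qed (use assms in \<open>auto intro!: X_closed R_in\<close>)

text \<open>
  On the range of \<open>R 0\<close> the approximants \<open>l R(l)\<close> of the identity have the explicit error \<open>R(l) F\<close>,
  which is of order \<open>1 / l\<close>.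
\<close>

lemma scale_R_R0:
  assumes "0 \<le> l" "F \<in> X"
  shows "l \<cdot> R l (R 0 F) = R 0 F - R l F"
proof -
  have RF: "R 0 F \<in> X" using assms by (simp add: R_in)
  have "R 0 F = R l (F + l \<cdot> R 0 F)"
    using resolvent_identity[of l 0 F] assms by simp
  also have "\<dots> = R l (F - (- l) \<cdot> R 0 F)" by simp
  also have "\<dots> = R l F - (- l) \<cdot> R l (R 0 F)"
    using assms RF by (simp only: R_diff R_scale X_scale)
  finally have "R 0 F = R l F + l \<cdot> R l (R 0 F)" by simp
  then show ?thesis by (metis add_diff_cancel_left')
qed

lemma neg_gen_R0: "F \<in> X \<Longrightarrow> neg_gen (R 0 F) F"
  using neg_gen_R[of 0 F] by simp

text \<open>
  The factor \<open>Suc n\<close> is the number of steps of length \<open>t / Suc n\<close> over which a one-step error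
  accumulates on \<open>[0,t]\<close>. The error per step is \<open>o(1 / Suc n)\<close>.
\<close>

lemma neg_gen_sequence:
  assumes "neg_gen g f" "0 < t"
  shows "(\<lambda>n. real (Suc n) * N (g - S (t / real (Suc n)) g - (t / real (Suc n)) \<cdot> f)) \<longlonglongrightarrow> 0"
proof -
  have "(\<lambda>n. t / real (Suc n)) \<longlonglongrightarrow> 0"
    using tendsto_mult_right_zero[OF LIMSEQ_inverse_real_of_nat, of t] by (simp add: divide_inverse)
  then have "filterlim (\<lambda>n. t / real (Suc n)) (at_right 0) sequentially"
    using assms(2) by (auto simp: filterlim_at intro!: always_eventually)
  from filterlim_compose[OF assms(1)[unfolded neg_gen_def] this]
  have "(\<lambda>n. t * (N (g - S (t / real (Suc n)) g - (t / real (Suc n)) \<cdot> f) / (t / real (Suc n)))) \<longlonglongrightarrow> 0"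
    by (intro tendsto_mult_right_zero)
  moreover have "t * (x / (t / real (Suc n))) = real (Suc n) * x" for x n
    using assms(2) by (simp add: field_simps)
  ultimately show ?thesis by (simp only:)
qed

text \<open>
  \<open>E = l R(l)\<close> and \<open>S\<^sub>h\<close> are commuting contractions, so replacing the factors of \<open>E\<^sup>n\<close> by \<open>S\<^sub>h\<close> one at a
  time costs the one-step error \<open>N (E g - S\<^sub>h g)\<close> each time.
\<close>

lemma implicit_euler_error:
  assumes l: "0 \<le> l" and h: "0 \<le> h" and g: "g \<in> X"
  shows "((\<lambda>F. l \<cdot> R l F) ^^ n) g \<in> X \<and>
    N (((\<lambda>F. l \<cdot> R l F) ^^ n) g - S (real n * h) g) \<le> real n * N (l \<cdot> R l g - S h g)"
proof (induction n)
  case 0 show ?case by (simp add: g S_zero_time N_0)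
next
  case (Suc n)
  define E where "E F = l \<cdot> R l F" for F
  define a where "a = (E ^^ n) g"
  define b where "b = S (real n * h) g"
  have a: "a \<in> X" "N (a - b) \<le> real n * N (E g - S h g)"
    using Suc by (simp_all add: a_def b_def E_def[abs_def])
  have b: "b \<in> X" using g h by (simp add: b_def S_in)
  have EX: "E F \<in> X" if "F \<in> X" for F using that l by (simp add: E_def R_in X_scale)
  have contr: "N (E F) \<le> N F" if "F \<in> X" for F
  proof -
    have "N (E F) = l * N (R l F)" using l by (simp add: E_def N_rscale)
    also have "\<dots> \<le> (l + w) * N (R l F)" using w_pos by (intro mult_right_mono N_nonneg) simp
    also have "\<dots> \<le> N F" using l that by (rule R_bound)
    finally show ?thesis .
  qed
  have Ediff: "E a - E b = E (a - b)"
    using a b l by (simp add: E_def R_diff scale_right_diff_distrib)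
  have Sn: "S (real (Suc n) * h) g = S (real n * h) (S h g)"
    using S_semigroup[of "real n * h" h g] h by (simp add: distrib_right add.commute)
  have Eb: "E b - S (real (Suc n) * h) g = S (real n * h) (E g - S h g)"
    unfolding Sn using l h g by (simp add: E_def b_def R_S S_diff S_scale)
  have "N (E a - S (real (Suc n) * h) g) \<le> N (E a - E b) + N (E b - S (real (Suc n) * h) g)"
    using a b g h by (intro N_diff_triangle EX S_in) auto
  also have "\<dots> \<le> N (a - b) + N (E g - S h g)"
    unfolding Ediff Eb using a b g h by (intro add_mono contr S_contraction X_closed EX) auto
  also have "\<dots> \<le> real (Suc n) * N (E g - S h g)"
    using a by (simp add: distrib_right)
  finally show ?case
    using EX[OF a(1)] by (simp add: a_def E_def[abs_def])
qed

end

section \<open>Subspaces invariant under the resolvent and under the semigroup\<close>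

locale closed_subspace_of_semigroup = resolvent_semigroup +
  fixes M :: "'a set"
  assumes subspace_M: "subspace M" and M_subset: "M \<subseteq> X"
    and M_closed: "(\<And>n. F n \<in> M) \<Longrightarrow> G \<in> X \<Longrightarrow> (\<lambda>n. N (F n - G)) \<longlonglongrightarrow> 0 \<Longrightarrow> G \<in> M"
begin

lemma M_in_X: "F \<in> M \<Longrightarrow> F \<in> X"
  using M_subset by blast

lemma M_closed_bound:
  assumes "\<And>n. F n \<in> M" "G \<in> X" "\<And>n. N (F n - G) \<le> e n" "e \<longlonglongrightarrow> 0"
  shows "G \<in> M"
proof (rule M_closed[OF assms(1,2)])
  show "(\<lambda>n. N (F n - G)) \<longlonglongrightarrow> 0"
    by (rule tendsto_sandwich[OF always_eventually always_eventually tendsto_const assms(4)])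
      (simp_all add: N_nonneg assms(3))
qed

text \<open>
  By \<open>resolvent_identity\<close>, \<open>R m f\<close> is the fixed point of \<open>G \<mapsto> R l (f + (l - m) G)\<close>, a map that contracts
  distances by \<open>\<bar>l - m\<bar> / (l + w) < 1\<close> and preserves \<open>M\<close>. Its iterates from \<open>0\<close>, the partial sums of the
  Neumann series, therefore stay in \<open>M\<close> and converge to \<open>R m f\<close>.
\<close>

lemma R_invariant_step:
  assumes inv: "\<And>F. F \<in> M \<Longrightarrow> R l F \<in> M" and l: "0 \<le> l" "0 \<le> m" "\<bar>l - m\<bar> < l + w" and f: "f \<in> M"
  shows "R m f \<in> M"
proof -
  define q where "q = \<bar>l - m\<bar> / (l + w)"
  have lw: "l + w > 0" using l(1) w_pos by simp
  have q: "0 \<le> q" "q < 1" using l lw by (auto simp: q_def)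
  have fX: "f \<in> X" "R m f \<in> X" using f l M_in_X R_in by auto
  define F where "F = rec_nat 0 (\<lambda>_ G. R l (f + (l - m) \<cdot> G))"
  have F0: "F 0 = 0" and FS: "F (Suc n) = R l (f + (l - m) \<cdot> F n)" for n by (auto simp: F_def)
  have FM: "F n \<in> M" for n
    by (induction n)
      (auto simp: F0 FS intro!: inv f subspace_add[OF subspace_M] subspace_scale[OF subspace_M] subspace_0[OF subspace_M])
  have "N (R m f - F n) \<le> q ^ n * N (R m f)" for n
  proof (induction n)
    case (Suc n)
    have D: "R m f - F n \<in> X" using FM M_in_X fX by (auto intro: X_closed)
    have "R m f - F (Suc n) = R l (f + (l - m) \<cdot> R m f) - R l (f + (l - m) \<cdot> F n)"
      using resolvent_identity[of l m f] l fX by (simp add: FS)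
    also have "\<dots> = R l ((f + (l - m) \<cdot> R m f) - (f + (l - m) \<cdot> F n))"
      using l fX FM[of n, THEN M_in_X] by (intro R_diff[symmetric] X_closed) auto
    also have "(f + (l - m) \<cdot> R m f) - (f + (l - m) \<cdot> F n) = (l - m) \<cdot> (R m f - F n)"
      by (simp add: scale_right_diff_distrib)
    also have "R l \<dots> = (l - m) \<cdot> R l (R m f - F n)"
      using l D by (intro R_scale) auto
    finally have "N (R m f - F (Suc n)) = \<bar>l - m\<bar> * N (R l (R m f - F n))"
      by (simp only: N_rscale)
    also have "\<dots> = q * ((l + w) * N (R l (R m f - F n)))"
      using lw by (simp add: q_def)
    also have "\<dots> \<le> q * N (R m f - F n)"
      using l D by (intro mult_left_mono q R_bound)
    also have "\<dots> \<le> q * (q ^ n * N (R m f))"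
      by (intro mult_left_mono q Suc)
    finally show ?case by simp
  qed (simp add: F0)
  then have le: "N (F n - R m f) \<le> q ^ n * N (R m f)" for n
    using N_commute by simp
  have "(\<lambda>n. q ^ n * N (R m f)) \<longlonglongrightarrow> 0"
    using q by (intro tendsto_mult_left_zero LIMSEQ_power_zero) simp
  with FM fX(2) le show ?thesis by (rule M_closed_bound)
qed

text \<open>
  Around any \<open>l \<ge> 0\<close> the previous step reaches all \<open>m \<ge> 0\<close> at distance less than \<open>w\<close>, so that finitely
  many steps of length \<open>w / 2\<close> lead from \<open>0\<close> to any \<open>m\<close>.
\<close>

lemma R_invariant:
  assumes "\<And>F. F \<in> M \<Longrightarrow> R 0 F \<in> M" "0 \<le> m" "f \<in> M"
  shows "R m f \<in> M"
proof -
  have *: "\<forall>m f. 0 \<le> m \<longrightarrow> m \<le> real n * (w / 2) \<longrightarrow> f \<in> M \<longrightarrow> R m f \<in> M" for n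
  proof (induction n)
    case 0 then show ?case using assms(1) by simp
  next
    case (Suc n)
    show ?case
    proof (intro allI impI)
      fix m f assume m: "0 \<le> m" "m \<le> real (Suc n) * (w / 2)" and f: "f \<in> M"
      define l where "l = max 0 (m - w / 2)"
      have "m - w / 2 \<le> real n * (w / 2)" "0 \<le> real n * (w / 2)"
        using m w_pos by (auto simp: algebra_simps)
      then have "l \<le> real n * (w / 2)" unfolding l_def by (rule max.boundedI[rotated])
      then have "\<And>F. F \<in> M \<Longrightarrow> R l F \<in> M" using Suc by (auto simp: l_def)
      then show "R m f \<in> M"
        by (rule R_invariant_step) (use m f w_pos in \<open>auto simp: l_def max_def\<close>)
    qed
  qed
  obtain n where "m \<le> real n * (w / 2)"
    using w_pos real_arch_simple[of "m / (w / 2)"] by (auto simp: field_simps)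
  then show ?thesis using *[of n] assms(2,3) by simp
qed

lemmas M_linear = subspace_add[OF subspace_M] subspace_diff[OF subspace_M]
  subspace_scale[OF subspace_M] subspace_sum[OF subspace_M]

text \<open>
  The approximants are \<open>(l R(l))\<^sup>n g\<close> with \<open>g = R(0)\<^sup>2 f\<close> and step \<open>h = 1 / l = t / n\<close>. On \<open>g\<close> both
  \<open>l R(l)\<close> and \<open>S\<^sub>h\<close> agree with \<open>1 - h R(0)\<^sup>-\<^sup>1\<close> up to \<open>o(h)\<close>: for \<open>S\<^sub>h\<close> this is the derivative of the
  orbit, and for \<open>l R(l)\<close> the error is \<open>h R(l) f\<close>, of size at most \<open>h\<^sup>2 N f\<close>. The second factor \<open>R(0)\<close>
  is what makes this last error small.
\<close>

lemma S_R_R_in_M: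
  assumes inv: "\<And>F. F \<in> M \<Longrightarrow> R 0 F \<in> M" and t: "0 < t" and f: "f \<in> M"
  shows "S t (R 0 (R 0 f)) \<in> M"
proof -
  define g where "g = R 0 (R 0 f)"
  define h where "h n = t / real (Suc n)" for n
  define l where "l n = 1 / h n" for n
  define e where "e n = N (g - S (h n) g - h n \<cdot> R 0 f)" for n
  define G where "G n = ((\<lambda>F. l n \<cdot> R (l n) F) ^^ Suc n) g" for n
  have gM: "g \<in> M" "R 0 f \<in> M" using f by (simp_all add: g_def inv)
  have fX: "f \<in> X" "R 0 f \<in> X" "g \<in> X" using f gM M_in_X by auto
  have h: "h n > 0" "l n > 0" "h n * l n = 1" for n using t by (simp_all add: h_def l_def)
  have nh: "real (Suc n) * h n = t" for n by (simp add: h_def)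
  have GM: "G n \<in> M" for n
  proof -
    have "((\<lambda>F. l n \<cdot> R (l n) F) ^^ k) g \<in> M" for k
      by (induction k)
        (auto simp: gM intro!: M_linear R_invariant[OF inv] less_imp_le[OF h(2)])
    then show ?thesis unfolding G_def by blast
  qed
  have euler_step: "N (l n \<cdot> R (l n) g - S (h n) g) \<le> e n + (h n)\<^sup>2 * N f" for n
  proof -
    have l0: "0 \<le> l n" using h(2)[of n] by simp
    have RX: "R (l n) f \<in> X" using l0 fX by (simp add: R_in)
    \<comment> \<open>The error \<open>h n \<cdot> R (l n) f\<close> comes from applying \<open>scale_R_R0\<close> twice, to \<open>R 0 f\<close> and to \<open>f\<close>.\<close>
    have "R (l n) (R 0 f) = (h n * l n) \<cdot> R (l n) (R 0 f)" by (simp only: h) simp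
    also have "\<dots> = h n \<cdot> (l n \<cdot> R (l n) (R 0 f))" by simp
    also have "\<dots> = h n \<cdot> (R 0 f - R (l n) f)" by (simp only: scale_R_R0[OF l0 fX(1)])
    finally have "l n \<cdot> R (l n) g = g - h n \<cdot> (R 0 f - R (l n) f)"
      by (simp only: g_def scale_R_R0[OF l0 fX(2)])
    then have eq: "l n \<cdot> R (l n) g - S (h n) g = (g - S (h n) g - h n \<cdot> R 0 f) + h n \<cdot> R (l n) f"
      by (simp add: scale_right_diff_distrib)
    have "N (l n \<cdot> R (l n) g - S (h n) g) \<le> e n + N (h n \<cdot> R (l n) f)"
      unfolding e_def eq using fX RX less_imp_le[OF h(1)[of n]]
      by (intro N_triangle X_closed)
    moreover have "N (h n \<cdot> R (l n) f) \<le> (h n)\<^sup>2 * N f"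
    proof -
      have "l n * N (R (l n) f) \<le> (l n + w) * N (R (l n) f)"
        using w_pos by (intro mult_right_mono N_nonneg) simp
      also have "\<dots> \<le> N f" using l0 fX(1) by (rule R_bound)
      finally have "(h n)\<^sup>2 * (l n * N (R (l n) f)) \<le> (h n)\<^sup>2 * N f"
        by (intro mult_left_mono) auto
      moreover have "(h n)\<^sup>2 * (l n * N (R (l n) f)) = h n * (h n * l n) * N (R (l n) f)"
        by (simp add: power2_eq_square)
      ultimately show ?thesis using h(1)[of n] by (simp add: h(3) N_rscale)
    qed
    ultimately show ?thesis by linarith
  qed
  have bound: "N (G n - S t g) \<le> real (Suc n) * e n + t\<^sup>2 * N f * inverse (real (Suc n))" for n
  proof -
    have "N (G n - S (real (Suc n) * h n) g) \<le> real (Suc n) * N (l n \<cdot> R (l n) g - S (h n) g)"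
      unfolding G_def using implicit_euler_error[of "l n" "h n" g "Suc n"] h[of n] fX by simp
    also have "\<dots> \<le> real (Suc n) * (e n + (h n)\<^sup>2 * N f)"
      by (intro mult_left_mono euler_step) auto
    also have "\<dots> = real (Suc n) * e n + t\<^sup>2 * N f * inverse (real (Suc n))"
      by (simp add: h_def power2_eq_square distrib_left divide_inverse)
    finally show ?thesis by (simp only: nh)
  qed
  have "(\<lambda>n. real (Suc n) * e n + t\<^sup>2 * N f * inverse (real (Suc n))) \<longlonglongrightarrow> 0 + 0"
    unfolding e_def h_def
    by (intro tendsto_add tendsto_mult_right_zero LIMSEQ_inverse_real_of_nat neg_gen_sequence t)
      (simp add: g_def neg_gen_R0 fX)
  then have lim: "(\<lambda>n. real (Suc n) * e n + t\<^sup>2 * N f * inverse (real (Suc n))) \<longlonglongrightarrow> 0" by simp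
  show ?thesis
    unfolding g_def[symmetric] by (rule M_closed_bound[OF GM _ bound lim]) (use t fX in \<open>simp add: S_in\<close>)
qed

text \<open>
  The orbit of \<open>R 0 g\<close> lies in \<open>M\<close> for positive times, and its derivative there is minus the orbit of
  \<open>g\<close>. So the latter is a limit of difference quotients in \<open>M\<close>.
\<close>

lemma S_in_M_from_R:
  assumes inv: "\<And>s. 0 < s \<Longrightarrow> S s (R 0 g) \<in> M" and t: "0 < t" and g: "g \<in> X"
  shows "S t g \<in> M"
proof -
  define h where "h n = 1 / real (Suc n)" for n
  define d where "d n = R 0 g - S (h n) (R 0 g) - h n \<cdot> g" for n
  define G where "G n = real (Suc n) \<cdot> (S t (R 0 g) - S (t + h n) (R 0 g))" for n
  have RX: "R 0 g \<in> X" using g by (simp add: R_in)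
  have h: "h n > 0" "real (Suc n) * h n = 1" for n by (simp_all add: h_def)
  have GM: "G n \<in> M" for n
    unfolding G_def using t h(1)[of n] by (intro M_linear inv) auto
  have le: "N (G n - S t g) \<le> real (Suc n) * N (d n)" for n
  proof -
    have "S t g = (real (Suc n) * h n) \<cdot> S t g" by (simp only: h(2) of_real_1 scale_one)
    also have "\<dots> = real (Suc n) \<cdot> (h n \<cdot> S t g)" by (simp only: scale_scale of_real_mult)
    finally have "G n - S t g = real (Suc n) \<cdot> ((S t (R 0 g) - S (t + h n) (R 0 g)) - h n \<cdot> S t g)"
      unfolding G_def scale_right_diff_distrib by simp
    also have "\<dots> = real (Suc n) \<cdot> S t (d n)"
      using t h(1)[of n] by (simp add: d_def S_diff S_scale S_semigroup)
    finally have "N (G n - S t g) = real (Suc n) * N (S t (d n))" by (simp only: N_rscale abs_of_nat)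
    also have "\<dots> \<le> real (Suc n) * N (d n)"
      using t g RX less_imp_le[OF h(1)[of n]]
      unfolding d_def by (intro mult_left_mono S_contraction X_closed) simp_all
    finally show ?thesis .
  qed
  have "(\<lambda>n. real (Suc n) * N (d n)) \<longlonglongrightarrow> 0"
    unfolding d_def h_def by (intro neg_gen_sequence neg_gen_R0 g) simp
  with GM _ le show ?thesis by (rule M_closed_bound) (use t g in \<open>simp add: S_in\<close>)
qed

lemma S_invariant_if_R_invariant:
  assumes inv: "\<And>F. F \<in> M \<Longrightarrow> R 0 F \<in> M" and t: "0 \<le> t" and f: "f \<in> M"
  shows "S t f \<in> M"
proof (cases "t = 0")
  case True then show ?thesis using f by (simp add: S_zero_time)
next
  case False
  have "S s (R 0 (R 0 f)) \<in> M" if "0 < s" for s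
    using inv that f by (rule S_R_R_in_M)
  then have "S s (R 0 f) \<in> M" if "0 < s" for s
    by (rule S_in_M_from_R) (use that M_in_X[OF f] in \<open>simp_all add: R_in\<close>)
  then show ?thesis
    by (rule S_in_M_from_R) (use False t M_in_X[OF f] in simp_all)
qed

text \<open>
  With \<open>g = R(0) f\<close>, the vector \<open>g - S\<^sub>T g\<close> telescopes into increments of the orbit of \<open>g\<close> over short
  intervals. Each increment is \<open>h S\<^sub>k\<^sub>h f\<close> up to \<open>o(h)\<close>, so \<open>g - S\<^sub>T g\<close> is a limit of vectors in \<open>M\<close>. Then
  \<open>T\<close> tends to infinity.
\<close>

lemma R_invariant_if_S_invariant:
  assumes inv: "\<And>t F. 0 \<le> t \<Longrightarrow> F \<in> M \<Longrightarrow> S t F \<in> M" and f: "f \<in> M"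
  shows "R 0 f \<in> M"
proof -
  define g where "g = R 0 f"
  have fX: "f \<in> X" "g \<in> X" using f M_in_X by (auto simp: g_def R_in)
  have partial: "g - S T g \<in> M" if T: "0 < T" for T
  proof -
    define h where "h n = T / real (Suc n)" for n
    define d where "d n = g - S (h n) g - h n \<cdot> f" for n
    define G where "G n = (\<Sum>k<Suc n. h n \<cdot> S (real k * h n) f)" for n
    have h: "h n > 0" "real (Suc n) * h n = T" for n using T by (simp_all add: h_def)
    have dX: "d n \<in> X" for n using fX h(1)[of n] by (auto simp: d_def intro!: X_closed)
    have GM: "G n \<in> M" for n
      unfolding G_def using h(1)[of n] f by (intro M_linear inv) auto
    have le: "N (G n - (g - S T g)) \<le> real (Suc n) * N (d n)" for n
    proof -
      have "(\<Sum>k<Suc n. S (real k * h n) g - S (real (Suc k) * h n) g) = g - S T g"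
        by (subst sum_lessThan_telescope') (simp only: h(2) S_zero_time of_nat_0 mult_zero_left)
      moreover have "S (real k * h n) (d n)
          = S (real k * h n) g - S (real (Suc k) * h n) g - h n \<cdot> S (real k * h n) f" for k
        using h(1)[of n] by (simp add: d_def S_diff S_scale S_semigroup) (simp add: algebra_simps)
      ultimately have "(\<Sum>k<Suc n. S (real k * h n) (d n)) = (g - S T g) - G n"
        by (simp only: sum_subtractf G_def)
      then have "N (G n - (g - S T g)) = N (\<Sum>k<Suc n. S (real k * h n) (d n))"
        by (simp only: N_commute[of "G n"])
      also have "\<dots> \<le> (\<Sum>k<Suc n. N (S (real k * h n) (d n)))"
        using dX h(1)[of n] by (intro N_sum S_in) auto
      also have "\<dots> \<le> (\<Sum>k<Suc n. N (d n))"
        using dX h(1)[of n] by (intro sum_mono S_contraction) auto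
      finally show ?thesis by simp
    qed
    have "(\<lambda>n. real (Suc n) * N (d n)) \<longlonglongrightarrow> 0"
      unfolding d_def h_def g_def by (intro neg_gen_sequence neg_gen_R0 fX T)
    with GM _ le show ?thesis by (rule M_closed_bound) (use T fX in \<open>simp add: X_closed\<close>)
  qed
  define T where "T n = real (Suc n)" for n
  have q: "exp (- w) < 1" using w_pos by simp
  have le: "N ((g - S (T n) g) - g) \<le> exp (- w) ^ Suc n * N g" for n
    using S_decay[of "T n" g] fX exp_of_nat_mult[of "Suc n" "- w"]
    by (simp add: N_minus T_def mult.commute del: of_nat_Suc power_Suc)
  have "(\<lambda>n. exp (- w) ^ Suc n * N g) \<longlonglongrightarrow> 0"
    by (intro tendsto_mult_left_zero LIMSEQ_Suc LIMSEQ_power_zero) (use q in simp)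
  with partial fX(2) le have "g \<in> M"
    by (rule M_closed_bound[where F = "\<lambda>n. g - S (T n) g"]) (simp add: T_def)
  then show ?thesis by (simp add: g_def)
qed

theorem R_invariant_iff_S_invariant:
  "R 0 ` M \<subseteq> M \<longleftrightarrow> (\<forall>t\<ge>0. S t ` M \<subseteq> M)"
proof
  assume "R 0 ` M \<subseteq> M"
  then show "\<forall>t\<ge>0. S t ` M \<subseteq> M" using S_invariant_if_R_invariant by blast
next
  assume "\<forall>t\<ge>0. S t ` M \<subseteq> M"
  then show "R 0 ` M \<subseteq> M" using R_invariant_if_S_invariant by blast
qed

end

section \<open>Borel representatives and the norm\<close>

lemma borel_in_unit_leb:
  fixes f :: "real \<Rightarrow> 'b::topological_space"
  assumes "f \<in> borel_measurable borel" shows "f \<in> borel_measurable unit_leb"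
  using assms by (simp add: measurable_completion measurable_restrict_space1)

lemma ae_rel_borel: "f \<in> borel_measurable borel \<Longrightarrow> ae_rel f f"
  by (simp add: ae_rel_def borel_in_unit_leb)

lemma abs_lfun_eqI:
  assumes "f \<in> borel_measurable borel" "g \<in> borel_measurable borel"
    and "\<And>x. x \<in> {0<..<1} \<Longrightarrow> f x = g x"
  shows "abs_lfun f = abs_lfun g"
proof -
  have "ae_rel f g"
    using assms by (auto simp: ae_rel_def borel_in_unit_leb intro!: AE_I2)
  then show ?thesis by (rule Quotient_rel_abs[OF Quotient_lfun])
qed

text \<open>
  Representatives are chosen Borel measurable, and not just Lebesgue measurable, so that
  \<open>(t, x) \<mapsto> f (\<phi>\<^sub>t x)\<close> is jointly measurable for the product of two copies of \<open>lborel\<close> and Tonelli's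
  theorem applies to it.
\<close>

lemma borel_representative:
  obtains f :: "real \<Rightarrow> complex" where "f \<in> borel_measurable borel" "F = abs_lfun f"
proof (induction F rule: lfun.abs_induct)
  case (1 g)
  then have g: "g \<in> borel_measurable unit_leb" by (simp add: ae_rel_def)
  define h where "h x = (if x \<in> {0<..<1} then g x else 0)" for x
  have h: "h \<in> borel_measurable lebesgue"
    unfolding h_def using g by (intro borel_measurable_if_I) auto
  obtain u where u: "u \<in> borel_measurable lborel" "AE x in lborel. Re (h x) = u x"
    using completion_ex_borel_measurable_real[of "\<lambda>x. Re (h x)" lborel] h by auto
  obtain v where v: "v \<in> borel_measurable lborel" "AE x in lborel. Im (h x) = v x"
    using completion_ex_borel_measurable_real[of "\<lambda>x. Im (h x)" lborel] h by auto
  define f where "f x = Complex (u x) (v x)" for x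
  have f: "f \<in> borel_measurable borel"
    using u(1) v(1) by (simp add: f_def[abs_def] borel_measurable_complex_iff)
  have "AE x in lborel. h x = f x"
    using u(2) v(2) by eventually_elim (simp add: f_def complex_eq_iff)
  then have "AE x in lebesgue. h x = f x" by (rule AE_completion)
  then have "AE x in unit_leb. g x = f x"
    by (subst AE_restrict_space_iff) (auto simp: h_def elim: AE_mp)
  then have "ae_rel g f" using g f by (simp add: ae_rel_def borel_in_unit_leb)
  then have "abs_lfun g = abs_lfun f" by (rule Quotient_rel_abs[OF Quotient_lfun])
  with f 1(2) show ?case by blast
qed

text \<open>
  The \<open>p\<close>-th power of the norm, with values in \<open>[0,\<infinity>]\<close>: estimates of it can be made before it is known
  that a function belongs to \<open>L\<^sup>p(0,1)\<close>, and then prove this (\<open>Lp_boundI\<close>).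
\<close>

definition pmass :: "real \<Rightarrow> (real \<Rightarrow> complex) \<Rightarrow> ennreal" where
  "pmass p f = (\<integral>\<^sup>+x\<in>{0<..<1}. ennreal (norm (f x) powr p) \<partial>lborel)"

lemma nn_integral_unit_leb:
  assumes "f \<in> borel_measurable borel"
  shows "(\<integral>\<^sup>+x. f x \<partial>unit_leb) = (\<integral>\<^sup>+x\<in>{0<..<1}. f x \<partial>lborel)"
  by (subst nn_integral_restrict_space) (simp_all add: nn_integral_completion)

lemma pmass_unit_leb:
  assumes [measurable]: "f \<in> borel_measurable borel"
  shows "pmass p f = (\<integral>\<^sup>+x. ennreal (norm (f x) powr p) \<partial>unit_leb)"
  unfolding pmass_def by (rule nn_integral_unit_leb[symmetric]) measurable

lemma Lp_abs_iff:
  assumes [measurable]: "f \<in> borel_measurable borel"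
  shows "abs_lfun f \<in> Lp p \<longleftrightarrow> pmass p f < \<infinity>"
proof -
  have "(\<lambda>x. norm (f x) powr p) \<in> borel_measurable unit_leb"
    by (rule borel_in_unit_leb) measurable
  then show ?thesis
    by (simp add: Lp_def p_integrable.abs_eq ae_rel_borel integrable_iff_bounded pmass_unit_leb)
qed

lemma Lp_norm_powr:
  assumes [measurable]: "f \<in> borel_measurable borel" and p: "0 < p" and "abs_lfun f \<in> Lp p"
  shows "pmass p f = ennreal (Lp_norm p (abs_lfun f) powr p)"
proof -
  have "integrable unit_leb (\<lambda>x. norm (f x) powr p)"
    using assms(3) by (simp add: Lp_def p_integrable.abs_eq ae_rel_borel)
  then have "pmass p f = ennreal (LINT x|unit_leb. norm (f x) powr p)"
    by (simp add: pmass_unit_leb nn_integral_eq_integral)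
  then show ?thesis
    using p by (simp add: Lp_norm.abs_eq ae_rel_borel powr_powr)
qed

lemma Lp_boundI:
  assumes f: "f \<in> borel_measurable borel" and p: "0 < p" and c: "0 \<le> c"
    and le: "pmass p f \<le> ennreal (c powr p)"
  shows "abs_lfun f \<in> Lp p" "Lp_norm p (abs_lfun f) \<le> c"
proof -
  show F: "abs_lfun f \<in> Lp p"
    using le_less_trans[OF le ennreal_less_top] by (simp add: Lp_abs_iff f)
  have "Lp_norm p (abs_lfun f) powr p \<le> c powr p"
    using le by (simp add: Lp_norm_powr[OF f p F])
  then show "Lp_norm p (abs_lfun f) \<le> c"
    using p c powr_less_mono2[of p c "Lp_norm p (abs_lfun f)"] by force
qed

section \<open>Norms of integrals of families of functions\<close>

text \<open>
  Jensen's inequality for the measure with density \<open>k\<close> and total mass \<open>K\<close>. It is obtained by integrating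
  Young's inequality \<open>c\<^bsup>p-1\<^esup> a \<le> a\<^sup>p / p + (1 - 1/p) c\<^sup>p\<close>, the tangent-line bound for the \<open>p\<close>-th power
  at \<open>c\<close>, with \<open>a = \<bar>G t\<bar>\<close> and \<open>c = \<bar>\<integral> k G\<bar> / K\<close>.
\<close>

lemma weighted_Jensen:
  fixes k :: "'a \<Rightarrow> real" and G :: "'a \<Rightarrow> complex"
  assumes p: "1 < p" and [measurable]: "k \<in> borel_measurable M" "G \<in> borel_measurable M"
    and k0: "\<And>t. 0 \<le> k t" and K: "0 < K" "(\<integral>\<^sup>+t. ennreal (k t) \<partial>M) = ennreal K"
  shows "ennreal (norm (LINT t|M. complex_of_real (k t) * G t) powr p)
    \<le> ennreal (K powr (p - 1)) * (\<integral>\<^sup>+t. ennreal (k t * norm (G t) powr p) \<partial>M)"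
proof -
  define I where "I = norm (LINT t|M. complex_of_real (k t) * G t)"
  define B where "B = (\<integral>\<^sup>+t. ennreal (k t * norm (G t) powr p) \<partial>M)"
  have nn: "ennreal I \<le> (\<integral>\<^sup>+t. ennreal (k t * norm (G t)) \<partial>M)"
  proof (cases "integrable M (\<lambda>t. complex_of_real (k t) * G t)")
    case True
    from integral_norm_bound_ennreal[OF this] show ?thesis
      using k0 by (simp add: I_def norm_mult)
  next
    case False then show ?thesis by (simp add: I_def not_integrable_integral_eq)
  qed
  consider "I = 0" | "B = \<infinity>" | b where "I > 0" "0 \<le> b" "B = ennreal b"
  proof -
    have "0 \<le> I" by (simp add: I_def)
    then show ?thesis using that by (cases B rule: ennreal_cases; cases "I = 0") auto
  qed
  then have "ennreal (I powr p) \<le> ennreal (K powr (p - 1)) * B"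
  proof cases
    case 1 then show ?thesis using p by simp
  next
    case 2 then show ?thesis using K by (simp add: ennreal_mult_top)
  next
    case 3
    define c where "c = I / K"
    define q where "q = p / (p - 1)"
    have c: "c > 0" using 3 K by (simp add: c_def)
    have q: "q > 1" "1 / p + 1 / q = 1" "(p - 1) * q = p" using p by (auto simp: q_def field_simps)
    have young: "c powr (p - 1) * norm (G t) \<le> norm (G t) powr p / p + c powr p / q" for t
      using Youngs_inequality[of p q "norm (G t)" "c powr (p - 1)"] p q
      by (simp add: powr_powr mult.commute)
    have "ennreal (c powr (p - 1) * I) = ennreal (c powr (p - 1)) * ennreal I"
      by (simp add: ennreal_mult' I_def)
    also have "\<dots> \<le> ennreal (c powr (p - 1)) * (\<integral>\<^sup>+t. ennreal (k t * norm (G t)) \<partial>M)"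
      by (intro mult_left_mono nn) simp
    also have "\<dots> = (\<integral>\<^sup>+t. ennreal (c powr (p - 1)) * ennreal (k t * norm (G t)) \<partial>M)"
      by (rule nn_integral_cmult[symmetric]) measurable
    also have "\<dots> \<le> (\<integral>\<^sup>+t. ennreal (1 / p) * ennreal (k t * norm (G t) powr p) + ennreal (c powr p / q) * ennreal (k t) \<partial>M)"
    proof (rule nn_integral_mono)
      fix t
      have "k t * (c powr (p - 1) * norm (G t)) \<le> k t * (norm (G t) powr p / p + c powr p / q)"
        by (intro mult_left_mono young k0)
      then have "c powr (p - 1) * (k t * norm (G t)) \<le> 1 / p * (k t * norm (G t) powr p) + c powr p / q * k t"
        by (simp add: algebra_simps)
      then show "ennreal (c powr (p - 1)) * ennreal (k t * norm (G t))
          \<le> ennreal (1 / p) * ennreal (k t * norm (G t) powr p) + ennreal (c powr p / q) * ennreal (k t)"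
        using p q k0[of t] by (simp add: ennreal_mult'[symmetric] ennreal_plus[symmetric] ennreal_leI del: ennreal_plus)
    qed
    also have "\<dots> = (\<integral>\<^sup>+t. ennreal (1 / p) * ennreal (k t * norm (G t) powr p) \<partial>M)
        + (\<integral>\<^sup>+t. ennreal (c powr p / q) * ennreal (k t) \<partial>M)"
      by (rule nn_integral_add) measurable
    also have "\<dots> = ennreal (1 / p) * B + ennreal (c powr p / q) * ennreal K"
      unfolding B_def K(2)[symmetric] by (intro arg_cong2[where f = "(+)"] nn_integral_cmult) measurable
    also have "\<dots> = ennreal (b / p + c powr p / q * K)"
      using 3 p q K by (simp add: ennreal_mult'[symmetric] ennreal_plus[symmetric] del: ennreal_plus)
    finally have "c powr (p - 1) * I \<le> b / p + c powr p / q * K"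
      using 3 p q K by (subst (asm) ennreal_le_iff) auto
    moreover have "c powr p * K = c powr (p - 1) * I"
      using c K 3(1) by (simp add: powr_diff c_def)
    ultimately have "c powr (p - 1) * I \<le> b / p + (c powr (p - 1) * I) / q" by simp
    moreover have "1 / q = 1 - 1 / p" using q by simp
    then have "(c powr (p - 1) * I) / q = (c powr (p - 1) * I) - (c powr (p - 1) * I) / p"
      by (metis (no_types) mult.right_neutral right_diff_distrib times_divide_eq_right)
    ultimately have "c powr (p - 1) * I \<le> b" using p by (simp add: divide_le_cancel)
    moreover have "I powr p = K powr (p - 1) * (c powr (p - 1) * I)"
      using 3 K by (simp add: c_def powr_divide powr_diff)
    ultimately have "I powr p \<le> K powr (p - 1) * b" by (simp add: mult_left_mono)
    then show ?thesis using 3 by (simp add: ennreal_mult'[symmetric] ennreal_leI)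
  qed
  then show ?thesis by (simp add: I_def B_def)
qed

text \<open>
  Minkowski's integral inequality for a family of functions whose norms are all at most \<open>c\<close>: Jensen's
  inequality at each \<open>x\<close>, and Tonelli's theorem to integrate over \<open>x\<close> first.
\<close>

lemma pmass_integral_le:
  fixes k :: "real \<Rightarrow> real" and G :: "real \<Rightarrow> real \<Rightarrow> complex"
  assumes p: "1 < p" and [measurable]: "k \<in> borel_measurable borel"
      "(\<lambda>(t, x). G t x) \<in> borel_measurable (borel \<Otimes>\<^sub>M borel)"
    and k0: "\<And>t. 0 \<le> k t" and K: "0 < K" "(\<integral>\<^sup>+t. ennreal (k t) \<partial>lborel) = ennreal K"
    and c: "\<And>t. k t \<noteq> 0 \<Longrightarrow> pmass p (G t) \<le> ennreal (c powr p)" and c0: "0 \<le> c"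
  shows "pmass p (\<lambda>x. LINT t|lborel. complex_of_real (k t) * G t x) \<le> ennreal ((K * c) powr p)"
proof -
  have "pmass p (\<lambda>x. LINT t|lborel. complex_of_real (k t) * G t x)
      \<le> (\<integral>\<^sup>+x. ennreal (K powr (p - 1)) *
        (\<integral>\<^sup>+t. ennreal (k t * norm (G t x) powr p) * indicator {0<..<1} x \<partial>lborel) \<partial>lborel)"
    unfolding pmass_def
  proof (rule nn_integral_mono)
    fix x :: real
    have "ennreal (norm (LINT t|lborel. complex_of_real (k t) * G t x) powr p)
        \<le> ennreal (K powr (p - 1)) * (\<integral>\<^sup>+t. ennreal (k t * norm (G t x) powr p) \<partial>lborel)"
      by (rule weighted_Jensen[OF p _ _ k0 K]) measurable
    then show "ennreal (norm (LINT t|lborel. complex_of_real (k t) * G t x) powr p) * indicator {0<..<1} x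
        \<le> ennreal (K powr (p - 1)) *
          (\<integral>\<^sup>+t. ennreal (k t * norm (G t x) powr p) * indicator {0<..<1} x \<partial>lborel)"
      by (simp split: split_indicator)
  qed
  also have "\<dots> = ennreal (K powr (p - 1)) *
      (\<integral>\<^sup>+x. \<integral>\<^sup>+t. ennreal (k t * norm (G t x) powr p) * indicator {0<..<1} x \<partial>lborel \<partial>lborel)"
    by (rule nn_integral_cmult) measurable
  also have "(\<integral>\<^sup>+x. \<integral>\<^sup>+t. ennreal (k t * norm (G t x) powr p) * indicator {0<..<1} x \<partial>lborel \<partial>lborel)
      = (\<integral>\<^sup>+t. \<integral>\<^sup>+x. ennreal (k t * norm (G t x) powr p) * indicator {0<..<1} x \<partial>lborel \<partial>lborel)"
    by (rule lborel_pair.Fubini') measurable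
  also have "\<dots> = (\<integral>\<^sup>+t. ennreal (k t) * pmass p (G t) \<partial>lborel)"
    unfolding pmass_def
    by (subst nn_integral_cmult[symmetric], measurable) (simp add: k0 ennreal_mult' mult.assoc)
  also have "\<dots> \<le> (\<integral>\<^sup>+t. ennreal (k t) * ennreal (c powr p) \<partial>lborel)"
  proof (rule nn_integral_mono)
    fix t show "ennreal (k t) * pmass p (G t) \<le> ennreal (k t) * ennreal (c powr p)"
      by (cases "k t = 0") (auto intro: mult_left_mono c)
  qed
  also have "\<dots> = ennreal K * ennreal (c powr p)"
    by (subst nn_integral_multc) (simp_all add: K)
  also have "ennreal (K powr (p - 1)) * (ennreal K * ennreal (c powr p)) = ennreal ((K * c) powr p)"
    using K c0 by (simp add: ennreal_mult'[symmetric] powr_mult powr_diff)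
  finally show ?thesis by (simp add: mult_left_mono)
qed

section \<open>The flow and the decay of the weighted composition operators\<close>

lemma phi_0: "phi 0 x = x"
  by (simp add: phi_def)

text \<open>
  \<open>phi t\<close> multiplies \<open>x / (1 - x)\<close> by \<open>exp (- t)\<close>, hence the flow property.
\<close>

lemma phi_phi:
  assumes x: "x \<in> {0<..<1}" shows "phi s (phi t x) = phi (s + t) x"
proof -
  define a b where "a = exp (- t)" and "b = exp (- s)"
  define d where "d = (a - 1) * x + 1"
  have d: "d > 0" using phi_denom_pos[OF x, of t] by (simp add: d_def a_def)
  have ab: "exp (- (s + t)) = b * a" by (simp add: a_def b_def flip: exp_add)
  have "(b * a - 1) * x + 1 > 0" using phi_denom_pos[OF x, of "s + t"] by (simp only: ab)
  moreover have "(b - 1) * (a * x / d) + 1 = ((b * a - 1) * x + 1) / d"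
    using d by (simp add: field_simps) (simp add: d_def algebra_simps)
  moreover have "phi t x = a * x / d" by (simp add: phi_def a_def d_def)
  moreover have "phi s y = b * y / ((b - 1) * y + 1)" for y by (simp add: phi_def b_def)
  moreover have "phi (s + t) x = b * a * x / ((b * a - 1) * x + 1)" by (simp only: phi_def ab)
  ultimately show ?thesis using d by simp
qed

lemma phi_le:
  assumes x: "x \<in> {0<..<1}" and t: "0 \<le> t" shows "phi t x \<le> x"
proof -
  have d: "0 < (exp (- t) - 1) * x + 1" by (rule phi_denom_pos[OF x])
  have "0 \<le> (1 - exp (- t)) * (1 - x)" using x t by (intro mult_nonneg_nonneg) auto
  then have "exp (- t) \<le> (exp (- t) - 1) * x + 1" by (simp add: algebra_simps)
  then have "exp (- t) * x \<le> ((exp (- t) - 1) * x + 1) * x"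
    using x by (intro mult_right_mono) auto
  then show ?thesis using d by (simp add: phi_def divide_le_eq mult.commute)
qed

lemma phi_strict_antimono:
  assumes x: "x \<in> {0<..<1}" and t: "0 < t" shows "phi t x < x"
proof -
  have d: "0 < (exp (- t) - 1) * x + 1" by (rule phi_denom_pos[OF x])
  have "0 < (1 - exp (- t)) * (1 - x)" using x t by (intro mult_pos_pos) auto
  then have "exp (- t) < (exp (- t) - 1) * x + 1" by (simp add: algebra_simps)
  then have "exp (- t) * x < ((exp (- t) - 1) * x + 1) * x"
    using x by (intro mult_strict_right_mono) auto
  then show ?thesis using d by (simp add: phi_def divide_less_eq mult.commute)
qed

lemma phi_deriv_time:
  assumes x: "x \<in> {0<..<1}"
  shows "((\<lambda>t. phi t x) has_real_derivative - (phi t x * (1 - phi t x))) (at t within A)"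
proof -
  define d where "d = (exp (- t) - 1) * x + 1"
  have d: "d > 0" using phi_denom_pos[OF x, of t] by (simp add: d_def)
  have "((\<lambda>t. exp (- t) * x / ((exp (- t) - 1) * x + 1)) has_real_derivative
      (- exp (- t) * x * d - exp (- t) * x * (- exp (- t) * x)) / (d * d)) (at t within A)"
    unfolding d_def using d by (auto intro!: derivative_eq_intros simp: d_def)
  moreover have "(- exp (- t) * x * d - exp (- t) * x * (- exp (- t) * x)) / (d * d)
      = - (exp (- t) * x / d * (1 - exp (- t) * x / d))"
    using d by (simp add: field_simps)
  ultimately show ?thesis by (simp add: phi_def[abs_def] d_def)
qed

lemma phi_deriv_space:
  assumes x: "x \<in> {0<..<1}"
  shows "(phi t has_real_derivative exp (- t) / ((exp (- t) - 1) * x + 1)\<^sup>2) (at x within A)"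
proof -
  define d where "d = (exp (- t) - 1) * x + 1"
  have d: "d > 0" using phi_denom_pos[OF x, of t] by (simp add: d_def)
  have "((\<lambda>x. exp (- t) * x / ((exp (- t) - 1) * x + 1)) has_real_derivative
      (exp (- t) * d - exp (- t) * x * (exp (- t) - 1)) / (d * d)) (at x within A)"
    unfolding d_def using d by (auto intro!: derivative_eq_intros simp: d_def)
  moreover have "exp (- t) * d - exp (- t) * x * (exp (- t) - 1) = exp (- t)"
    by (simp add: d_def algebra_simps)
  ultimately show ?thesis by (simp add: phi_def[abs_def] d_def power2_eq_square)
qed

lemma phi_image: "phi t ` {0<..<1} = {0<..<1}"
proof
  show "{0<..<1} \<subseteq> phi t ` {0<..<1}"
  proof
    fix y :: real assume "y \<in> {0<..<1}"
    then show "y \<in> phi t ` {0<..<1}"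
      using phi_inverse[of y "- t"] phi_in[of y "- t"] by (intro image_eqI[of _ _ "phi (- t) y"]) auto
  qed
qed (use phi_in in auto)

lemma inj_on_phi: "inj_on (phi t) {0<..<1}"
  by (rule inj_on_inverseI[of _ "phi (- t)"]) (rule phi_inverse)

lemma phi_time_image:
  assumes x: "x \<in> {0<..<1}" shows "(\<lambda>t. phi t x) ` {0<..} = {0<..<x}"
proof
  show "(\<lambda>t. phi t x) ` {0<..} \<subseteq> {0<..<x}"
    using phi_in[OF x] phi_strict_antimono[OF x] by auto
  show "{0<..<x} \<subseteq> (\<lambda>t. phi t x) ` {0<..}"
  proof
    fix y assume y: "y \<in> {0<..<x}"
    \<comment> \<open>\<open>r\<close> is the quotient of \<open>x / (1 - x)\<close> by \<open>y / (1 - y)\<close>, so the flow takes time \<open>ln r\<close> from \<open>x\<close> to \<open>y\<close>.\<close>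
    define r where "r = x * (1 - y) / (y * (1 - x))"
    have r: "r > 1" using x y by (simp add: r_def algebra_simps)
    have "exp (- ln r) = y * (1 - x) / (x * (1 - y))"
      using r by (simp add: exp_minus r_def inverse_eq_divide)
    then have "phi (ln r) x = (y * (1 - x) / (x * (1 - y)) * x) / ((y * (1 - x) / (x * (1 - y)) - 1) * x + 1)"
      by (simp only: phi_def)
    also have "(y * (1 - x) / (x * (1 - y)) - 1) * x + 1 = (1 - x) / (1 - y)"
      using x y by (simp add: field_simps)
    also have "(y * (1 - x) / (x * (1 - y)) * x) / ((1 - x) / (1 - y)) = y"
      using x y by simp
    finally show "y \<in> (\<lambda>t. phi t x) ` {0<..}"
      using r by (intro image_eqI[of _ _ "ln r"]) auto
  qed
qed

lemma inj_on_phi_time: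
  assumes x: "x \<in> {0<..<1}" shows "inj_on (\<lambda>t. phi t x) A"
proof (rule inj_onI)
  fix s t assume eq: "phi s x = phi t x"
  have "phi (- t) (phi s x) = x" using phi_inverse[OF x, of t] by (simp add: eq)
  then have fix1: "phi (s - t) x = x" using phi_phi[OF x, of "- t" s] by simp
  then have fix2: "phi (t - s) x = x" using phi_inverse[OF x, of "s - t"] by simp
  show "s = t"
    using phi_strict_antimono[OF x, of "s - t"] phi_strict_antimono[OF x, of "t - s"] fix1 fix2
    by (cases s t rule: linorder_cases) auto
qed

lemma phi_measurable2 [measurable (raw)]:
  assumes [measurable]: "f \<in> borel_measurable M" "g \<in> borel_measurable M"
  shows "(\<lambda>z. phi (f z) (g z)) \<in> borel_measurable M"
  unfolding phi_def by measurable

definition wcomp :: "real \<Rightarrow> (real \<Rightarrow> complex) \<Rightarrow> real \<Rightarrow> complex" where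
  "wcomp t f x = complex_of_real (phi t x / x) * f (phi t x)"

lemma wcomp_measurable2 [measurable (raw)]:
  assumes [measurable]: "f \<in> borel_measurable borel" "u \<in> borel_measurable M" "v \<in> borel_measurable M"
  shows "(\<lambda>z. wcomp (u z) f (v z)) \<in> borel_measurable M"
  unfolding wcomp_def by measurable

lemma S_op_abs: "f \<in> borel_measurable borel \<Longrightarrow> S_op t (abs_lfun f) = abs_lfun (wcomp t f)"
  by (simp add: S_op.abs_eq ae_rel_borel wcomp_def[abs_def])

lemma wcomp_wcomp:
  "x \<in> {0<..<1} \<Longrightarrow> wcomp s (wcomp t f) x = wcomp (s + t) f x"
  using phi_in[of x s] by (simp add: wcomp_def phi_phi add.commute)

text \<open>
  The two arguments of \<open>min\<close> belong to \<open>p \<ge> 2\<close> and \<open>p \<le> 2\<close>: the weight in \<open>weight_bound\<close> attains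
  its largest value at \<open>q = 1\<close> in the first case and at \<open>q = exp (- t)\<close> in the second.
\<close>

definition decay_rate :: "real \<Rightarrow> real" where
  "decay_rate p = min 1 (p - 1) / p"

lemma decay_rate_pos: "1 < p \<Longrightarrow> 0 < decay_rate p"
  by (simp add: decay_rate_def)

lemma weight_bound:
  assumes "1 < p" "0 \<le> t" "exp (- t) \<le> q" "q \<le> 1"
  shows "exp (- t) * q powr (p - 2) \<le> exp (- decay_rate p * t) powr p"
proof -
  have "0 < q" using assms(3) exp_gt_zero[of "- t"] by linarith
  have "exp (- decay_rate p * t) powr p = exp (- (min 1 (p - 1) * t))"
    using assms(1) by (simp add: exp_powr_real decay_rate_def)
  moreover have "exp (- t) * q powr (p - 2) \<le> exp (- (min 1 (p - 1) * t))"
  proof (cases "2 \<le> p")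
    case True
    have "q powr (p - 2) \<le> 1" using True assms \<open>0 < q\<close> by (intro powr_le1) auto
    then show ?thesis using True by (simp add: mult_left_le)
  next
    case False
    have "q powr (p - 2) \<le> exp (- t) powr (p - 2)"
      using False assms by (intro powr_mono2') auto
    also have "\<dots> = exp (- t * (p - 2))" by (simp add: exp_powr_real)
    finally have "exp (- t) * q powr (p - 2) \<le> exp (- t) * exp (- t * (p - 2))" by simp
    also have "\<dots> = exp (- ((p - 1) * t))" by (simp add: exp_add[symmetric] algebra_simps)
    finally show ?thesis using False by simp
  qed
  ultimately show ?thesis by simp
qed

text \<open>
  Substituting \<open>x = phi (- t) s\<close> gives the integral of \<open>\<bar>f s\<bar>\<^sup>p\<close> against the weight
  \<open>exp (- t) * q powr (p - 2)\<close>, where \<open>q = s / x = s + exp (- t) * (1 - s)\<close> lies between \<open>exp (- t)\<close>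
  and \<open>1\<close>: the factor \<open>(phi t x / x)\<^sup>p\<close> contributes \<open>q\<^sup>p\<close>, and the derivative of \<open>phi (- t)\<close> contributes
  \<open>exp (- t) / q\<^sup>2\<close>.
\<close>

lemma pmass_wcomp_le:
  assumes p: "1 < p" and t: "0 \<le> t" and f[measurable]: "f \<in> borel_measurable borel"
  shows "pmass p (wcomp t f) \<le> ennreal (exp (- decay_rate p * t) powr p) * pmass p f"
proof (cases "pmass p f = \<infinity>")
  case True then show ?thesis by (simp add: ennreal_mult_top)
next
  case False
  define c where "c = exp (- decay_rate p * t) powr p"
  define D where "D s = (exp t - 1) * s + 1" for s
  define H where "H x = norm (wcomp t f x) powr p" for x
  define J where "J s = \<bar>exp t / (D s)\<^sup>2\<bar> *\<^sub>R H (phi (- t) s)" for s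
  have [measurable]: "H \<in> borel_measurable borel" "J \<in> borel_measurable borel" "D \<in> borel_measurable borel"
    unfolding J_def D_def[abs_def] H_def[abs_def] by measurable
  have le: "J s \<le> c * norm (f s) powr p" if s: "s \<in> {0<..<1}" for s
  proof -
    have D: "D s > 0" using phi_denom_pos[OF s, of "- t"] by (simp add: D_def)
    define q where "q = D s / exp t"
    have q: "q > 0" using D by (simp add: q_def)
    have qeq: "q = s + exp (- t) * (1 - s)" by (simp add: q_def D_def field_simps exp_minus)
    have "exp (- t) * s \<le> s" "exp (- t) * (1 - s) \<le> 1 - s"
      using s t by (simp_all add: mult_left_le_one_le)
    then have q1: "exp (- t) \<le> q" "q \<le> 1" by (simp_all add: qeq algebra_simps)
    have "phi (- t) s = s / q" using D by (simp add: phi_def q_def D_def)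
    moreover have "phi t (phi (- t) s) = s" using phi_inverse[OF s, of "- t"] by simp
    ultimately have "wcomp t f (phi (- t) s) = complex_of_real q * f s"
      using s q by (simp add: wcomp_def)
    then have "H (phi (- t) s) = q powr p * norm (f s) powr p"
      using q by (simp add: H_def norm_mult powr_mult)
    moreover have "exp t / (D s)\<^sup>2 = exp (- t) / q\<^sup>2"
      by (simp add: q_def power_divide exp_minus field_simps power2_eq_square)
    ultimately have "J s = (exp (- t) / q\<^sup>2) * (q powr p * norm (f s) powr p)"
      using q by (simp add: J_def)
    also have "\<dots> = exp (- t) * q powr (p - 2) * norm (f s) powr p"
      using q by (simp add: powr_diff powr_numeral)
    also have "\<dots> \<le> c * norm (f s) powr p"
      unfolding c_def by (intro mult_right_mono weight_bound p t q1) simp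
    finally show ?thesis .
  qed
  have J0: "0 \<le> J s" for s by (simp add: J_def H_def)
  have F: "integrable unit_leb (\<lambda>s. norm (f s) powr p)"
    using False borel_in_unit_leb[of "\<lambda>s. norm (f s) powr p"]
    by (simp add: integrable_iff_bounded pmass_unit_leb top.not_eq_extremum)
  have "integrable unit_leb J"
    by (rule Bochner_Integration.integrable_bound[OF integrable_mult_right[OF F, of c] borel_in_unit_leb])
      (use le J0 in \<open>auto intro!: AE_I2 order_trans[OF _ abs_ge_self]\<close>)
  then have Jabs: "J absolutely_integrable_on {0<..<1}"
    by (simp add: set_integrable_def integrable_restrict_space)
  have "(phi (- t) has_real_derivative exp t / (D s)\<^sup>2) (at s within {0<..<1})" if "s \<in> {0<..<1}" for s
    using phi_deriv_space[OF that, of "- t"] by (simp add: D_def)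
  then have "H absolutely_integrable_on phi (- t) ` {0<..<1} \<and>
      integral (phi (- t) ` {0<..<1}) H = integral {0<..<1} J"
    using Jabs inj_on_phi[of "- t"] unfolding J_def
    by (subst has_absolute_integral_change_of_variables_real[symmetric]) auto
  then have H: "H absolutely_integrable_on {0<..<1}" "integral {0<..<1} H = integral {0<..<1} J"
    by (simp_all add: phi_image)
  have "pmass p (wcomp t f) = (\<integral>\<^sup>+x. ennreal (H x) \<partial>unit_leb)"
    unfolding H_def by (rule pmass_unit_leb) measurable
  also have "\<dots> = ennreal (LINT x|unit_leb. H x)"
    using H(1) by (intro nn_integral_eq_integral) (simp_all add: set_integrable_def integrable_restrict_space H_def)
  also have "(LINT x|unit_leb. H x) = (LINT x|unit_leb. J x)"
    using H Jabs set_lebesgue_integral_eq_integral(2)[of "{0<..<1}" H] set_lebesgue_integral_eq_integral(2)[of "{0<..<1}" J]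
    by (simp add: set_lebesgue_integral_def integral_restrict_space)
  also have "\<dots> \<le> (LINT s|unit_leb. c * norm (f s) powr p)"
    by (intro integral_mono \<open>integrable unit_leb J\<close> integrable_mult_right F) (simp add: le)
  also have "\<dots> = c * (LINT s|unit_leb. norm (f s) powr p)" by simp
  finally show ?thesis
    using F by (simp add: c_def pmass_unit_leb nn_integral_eq_integral ennreal_mult' ennreal_leI)
qed

section \<open>The semigroup on classes of functions\<close>

lemma abs_lfun_diff: "f \<in> borel_measurable borel \<Longrightarrow> g \<in> borel_measurable borel \<Longrightarrow>
    abs_lfun f - abs_lfun g = abs_lfun (\<lambda>x. f x - g x)"
  by (simp add: minus_lfun.abs_eq ae_rel_borel)

lemma abs_lfun_add: "f \<in> borel_measurable borel \<Longrightarrow> g \<in> borel_measurable borel \<Longrightarrow>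
    abs_lfun f + abs_lfun g = abs_lfun (\<lambda>x. f x + g x)"
  by (simp add: plus_lfun.abs_eq ae_rel_borel)

lemma abs_lfun_scale: "f \<in> borel_measurable borel \<Longrightarrow>
    scale_lfun c (abs_lfun f) = abs_lfun (\<lambda>x. c * f x)"
  by (simp add: scale_lfun.abs_eq ae_rel_borel)

lemma Lp_norm_scale: "0 < p \<Longrightarrow> Lp_norm p (scale_lfun c F) = norm c * Lp_norm p F"
  by transfer (simp add: norm_mult powr_mult powr_powr)

lemma Lp_diff: "1 < p \<Longrightarrow> F \<in> Lp p \<Longrightarrow> G \<in> Lp p \<Longrightarrow> F - G \<in> Lp p"
  by (intro lfun.subspace_diff subspace_Lp) auto

lemma Lp_norm_diff_triangle:
  "1 < p \<Longrightarrow> F \<in> Lp p \<Longrightarrow> G \<in> Lp p \<Longrightarrow> H \<in> Lp p \<Longrightarrow>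
    Lp_norm p (F - H) \<le> Lp_norm p (F - G) + Lp_norm p (G - H)"
  using Lp_norm_triangle[of p "F - G" "G - H"] by (simp add: Lp_diff)

lemma S_op_bound:
  assumes p: "1 < p" and t: "0 \<le> t" and F: "F \<in> Lp p"
  shows "S_op t F \<in> Lp p" "Lp_norm p (S_op t F) \<le> exp (- decay_rate p * t) * Lp_norm p F"
proof -
  obtain f where f[measurable]: "f \<in> borel_measurable borel" and Ff: "F = abs_lfun f"
    by (rule borel_representative)
  have "pmass p (wcomp t f) \<le> ennreal (exp (- decay_rate p * t) powr p) * pmass p f"
    by (rule pmass_wcomp_le[OF p t f])
  also have "\<dots> = ennreal ((exp (- decay_rate p * t) * Lp_norm p F) powr p)"
    using p F by (simp add: Ff Lp_norm_powr[OF f] powr_mult ennreal_mult' Lp_norm_nonneg)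
  finally have le: "pmass p (wcomp t f) \<le> ennreal ((exp (- decay_rate p * t) * Lp_norm p F) powr p)" .
  have "wcomp t f \<in> borel_measurable borel" by measurable
  from Lp_boundI[OF this _ _ le] p
  show "S_op t F \<in> Lp p" "Lp_norm p (S_op t F) \<le> exp (- decay_rate p * t) * Lp_norm p F"
    by (simp_all add: Ff S_op_abs Lp_norm_nonneg)
qed

lemma S_op_contraction:
  assumes p: "1 < p" and t: "0 \<le> t" and F: "F \<in> Lp p"
  shows "Lp_norm p (S_op t F) \<le> Lp_norm p F"
proof -
  have "exp (- decay_rate p * t) * Lp_norm p F \<le> 1 * Lp_norm p F"
    using t decay_rate_pos[OF p] by (intro mult_right_mono Lp_norm_nonneg) simp
  with S_op_bound(2)[OF assms] show ?thesis by simp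
qed

lemma S_op_add: "S_op t (F + G) = S_op t F + S_op t G"
proof -
  obtain f where f[measurable]: "f \<in> borel_measurable borel" "F = abs_lfun f" by (rule borel_representative)
  obtain g where g[measurable]: "g \<in> borel_measurable borel" "G = abs_lfun g" by (rule borel_representative)
  show ?thesis
    by (simp add: f g abs_lfun_add S_op_abs) (simp add: wcomp_def[abs_def] distrib_left add_divide_distrib)
qed

lemma S_op_scale: "S_op t (scale_lfun c F) = scale_lfun c (S_op t F)"
proof -
  obtain f where f[measurable]: "f \<in> borel_measurable borel" "F = abs_lfun f" by (rule borel_representative)
  show ?thesis
    by (simp add: f abs_lfun_scale S_op_abs) (simp add: wcomp_def[abs_def] mult.left_commute)
qed

lemma S_op_diff: "S_op t (F - G) = S_op t F - S_op t G"
  using S_op_add[of t "F - G" G] by (simp add: algebra_simps)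

lemma S_op_0: "S_op 0 F = F"
proof -
  obtain f where f[measurable]: "f \<in> borel_measurable borel" "F = abs_lfun f" by (rule borel_representative)
  have "abs_lfun (wcomp 0 f) = abs_lfun f"
    by (rule abs_lfun_eqI) (auto simp: wcomp_def phi_0)
  then show ?thesis by (simp add: f S_op_abs)
qed

lemma S_op_S_op: "S_op s (S_op t F) = S_op (s + t) F"
proof -
  obtain f where f[measurable]: "f \<in> borel_measurable borel" "F = abs_lfun f" by (rule borel_representative)
  have "abs_lfun (wcomp s (wcomp t f)) = abs_lfun (wcomp (s + t) f)"
    by (rule abs_lfun_eqI) (auto simp: wcomp_wcomp)
  then show ?thesis by (simp add: f S_op_abs)
qed

section \<open>Strong continuity\<close>

lemma Lp_norm_eq_LINT:
  "f \<in> borel_measurable borel \<Longrightarrow>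
    Lp_norm p (abs_lfun f) = (LINT x|unit_leb. norm (f x) powr p) powr (1 / p)"
  by (simp add: Lp_norm.abs_eq ae_rel_borel)

lemma Lp_dominated_convergence:
  fixes f :: "nat \<Rightarrow> real \<Rightarrow> complex"
  assumes p: "1 < p" and [measurable]: "\<And>n. f n \<in> borel_measurable borel" "g \<in> borel_measurable borel"
    and lim: "AE x in unit_leb. (\<lambda>n. f n x) \<longlonglongrightarrow> g x"
    and b: "integrable unit_leb (\<lambda>x. b x powr p)" "\<And>n x. x \<in> {0<..<1} \<Longrightarrow> norm (f n x - g x) \<le> b x"
  shows "(\<lambda>n. Lp_norm p (abs_lfun (f n) - abs_lfun g)) \<longlonglongrightarrow> 0"
proof -
  have "(\<lambda>n. LINT x|unit_leb. norm (f n x - g x) powr p) \<longlonglongrightarrow> (LINT x|unit_leb. 0)"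
  proof (rule integral_dominated_convergence)
    show "(\<lambda>x. norm (f n x - g x) powr p) \<in> borel_measurable unit_leb" for n
      by (rule borel_in_unit_leb) measurable
    show "AE x in unit_leb. (\<lambda>n. norm (f n x - g x) powr p) \<longlonglongrightarrow> 0"
      using lim
    proof eventually_elim
      case (elim x)
      then have "(\<lambda>n. norm (f n x - g x)) \<longlonglongrightarrow> 0" by (simp add: LIM_zero tendsto_norm_zero)
      then show ?case using p by (intro tendsto_zero_powrI[where b = p]) auto
    qed
    show "AE x in unit_leb. norm (norm (f n x - g x) powr p) \<le> b x powr p" for n
      using b(2) p by (intro AE_I2) (auto intro!: powr_mono2)
  qed (use b in auto)
  then have "(\<lambda>n. (LINT x|unit_leb. norm (f n x - g x) powr p) powr (1 / p)) \<longlonglongrightarrow> 0"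
    using p by (intro tendsto_zero_powrI[where b = "1 / p"]) auto
  then show ?thesis by (simp add: abs_lfun_diff Lp_norm_eq_LINT)
qed

lemma integrable_unit_leb_const: "integrable unit_leb (\<lambda>x. c :: real)"
proof -
  interpret finite_measure unit_leb
    by (rule finite_measureI) (simp add: emeasure_restrict_space)
  show ?thesis by simp
qed

lemma Lp_bounded:
  assumes "1 < p" and [measurable]: "f \<in> borel_measurable borel" and "\<And>x. norm (f x) \<le> B"
  shows "abs_lfun f \<in> Lp p"
proof -
  have "integrable unit_leb (\<lambda>x. norm (f x) powr p)"
    by (rule Bochner_Integration.integrable_bound[OF integrable_unit_leb_const[of "B powr p"]])
      (use assms in \<open>auto intro!: AE_I2 powr_mono2 borel_in_unit_leb\<close>)
  then show ?thesis by (simp add: Lp_def p_integrable.abs_eq ae_rel_borel)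
qed

definition continuity_vectors :: "real \<Rightarrow> lfun set" where
  "continuity_vectors p = {F \<in> Lp p. ((\<lambda>h. Lp_norm p (S_op h F - F)) \<longlongrightarrow> 0) (at_right 0)}"

text \<open>
  A three-epsilon argument, in which the first of the three terms is controlled uniformly in \<open>h\<close> because
  the operators \<open>S_op h\<close> are contractions.
\<close>

lemma continuity_vectors_closed:
  assumes p: "1 < p" and F: "\<And>n. F n \<in> continuity_vectors p" and G: "G \<in> Lp p"
    and lim: "(\<lambda>n. Lp_norm p (F n - G)) \<longlonglongrightarrow> 0"
  shows "G \<in> continuity_vectors p"
proof -
  have "((\<lambda>h. Lp_norm p (S_op h G - G)) \<longlongrightarrow> 0) (at_right 0)"
  proof (rule tendstoI)
    fix e :: real assume e: "e > 0"
    obtain n where n: "Lp_norm p (F n - G) < e / 3"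
      using order_tendstoD(2)[OF lim, of "e / 3"] e by (auto simp: eventually_sequentially)
    have Fn: "F n \<in> Lp p" "((\<lambda>h. Lp_norm p (S_op h (F n) - F n)) \<longlongrightarrow> 0) (at_right 0)"
      using F[of n] by (auto simp: continuity_vectors_def)
    have "\<forall>\<^sub>F h in at_right 0. Lp_norm p (S_op h (F n) - F n) < e / 3"
      using order_tendstoD(2)[OF Fn(2), of "e / 3"] e by simp
    then show "\<forall>\<^sub>F h in at_right 0. dist (Lp_norm p (S_op h G - G)) 0 < e"
      using eventually_at_right_less[of 0]
    proof eventually_elim
      case (elim h)
      have S: "S_op h G \<in> Lp p" "S_op h (F n) \<in> Lp p"
        using p elim G Fn by (simp_all add: S_op_bound)
      have "Lp_norm p (S_op h G - S_op h (F n)) \<le> Lp_norm p (G - F n)"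
        using p elim G Fn unfolding S_op_diff[symmetric] by (intro S_op_contraction Lp_diff) auto
      then have "Lp_norm p (S_op h G - S_op h (F n)) < e / 3"
        using n by (simp add: Lp_norm_minus_commute[of p G])
      moreover have "Lp_norm p (S_op h G - G) \<le> Lp_norm p (S_op h G - S_op h (F n)) + Lp_norm p (S_op h (F n) - G)"
        using p S G by (intro Lp_norm_diff_triangle)
      moreover have "Lp_norm p (S_op h (F n) - G) \<le> Lp_norm p (S_op h (F n) - F n) + Lp_norm p (F n - G)"
        using p S G Fn by (intro Lp_norm_diff_triangle)
      ultimately show ?case using elim n by (simp add: Lp_norm_nonneg)
    qed
  qed
  then show ?thesis using G by (simp add: continuity_vectors_def)
qed

text \<open>
  As \<open>h\<close> tends to \<open>0\<close>, \<open>phi h x\<close> tends to \<open>x\<close>, and the weight \<open>phi h x / x\<close> is at most \<open>1\<close>, so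
  that dominated convergence applies.
\<close>

lemma continuity_vectors_continuous:
  assumes p: "1 < p" and g: "continuous_on UNIV g" "\<And>x. norm (g x) \<le> B"
  shows "abs_lfun g \<in> continuity_vectors p"
proof -
  have [measurable]: "g \<in> borel_measurable borel" using g(1) by (rule borel_measurable_continuous_onI)
  have "((\<lambda>h. Lp_norm p (S_op h (abs_lfun g) - abs_lfun g)) \<longlongrightarrow> 0) (at_right 0)"
    unfolding tendsto_at_iff_sequentially
  proof (intro allI impI)
    fix h :: "nat \<Rightarrow> real" assume h: "\<forall>i. h i \<in> {0<..} - {0}" "h \<longlonglongrightarrow> 0"
    have "(\<lambda>n. Lp_norm p (abs_lfun (wcomp (h n) g) - abs_lfun g)) \<longlonglongrightarrow> 0"
    proof (rule Lp_dominated_convergence[OF p])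
      show "integrable unit_leb (\<lambda>x. (2 * B) powr p)" by (rule integrable_unit_leb_const)
      show "norm (wcomp (h n) g x - g x) \<le> 2 * B" if x: "x \<in> {0<..<1}" for n x
      proof -
        have "0 < h n" using h(1) by auto
        then have "phi (h n) x / x \<le> 1" "0 \<le> phi (h n) x / x"
          using phi_le[OF x, of "h n"] phi_in[OF x, of "h n"] x by auto
        then have "norm (wcomp (h n) g x) \<le> 1 * B"
          unfolding wcomp_def norm_mult norm_of_real by (intro mult_mono g(2)) auto
        then show ?thesis using norm_triangle_ineq4[of "wcomp (h n) g x" "g x"] g(2)[of x] by simp
      qed
      show "AE x in unit_leb. (\<lambda>n. wcomp (h n) g x) \<longlonglongrightarrow> g x"
      proof (rule AE_I2)
        fix x assume "x \<in> space unit_leb"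
        then have x: "x \<in> {0<..<1}" by simp
        have "isCont (\<lambda>t. phi t x) 0" by (rule DERIV_isCont[OF phi_deriv_time[OF x]])
        from isCont_tendsto_compose[OF this h(2)] have ph: "(\<lambda>n. phi (h n) x) \<longlonglongrightarrow> x"
          by (simp add: phi_0)
        have "isCont g x" using g(1) by (simp add: continuous_on_eq_continuous_at)
        from isCont_tendsto_compose[OF this ph] have "(\<lambda>n. g (phi (h n) x)) \<longlonglongrightarrow> g x" .
        then have "(\<lambda>n. wcomp (h n) g x) \<longlonglongrightarrow> complex_of_real (x / x) * g x"
          unfolding wcomp_def using x by (intro tendsto_intros ph) auto
        then show "(\<lambda>n. wcomp (h n) g x) \<longlonglongrightarrow> g x" using x by simp
      qed
    qed measurable
    then show "((\<lambda>h. Lp_norm p (S_op h (abs_lfun g) - abs_lfun g)) \<circ> h) \<longlonglongrightarrow> 0"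
      by (simp add: o_def S_op_abs)
  qed
  then show ?thesis
    using Lp_bounded[OF p _ g(2)] by (simp add: continuity_vectors_def)
qed

text \<open>
  The radial retraction of the plane onto the disc of radius \<open>B\<close>. It bounds approximants by \<open>B\<close> while
  keeping them continuous and keeping their limits, if these lie in the disc.
\<close>

definition clip :: "real \<Rightarrow> complex \<Rightarrow> complex" where
  "clip B z = of_real (B / max B (norm z)) * z"

lemma norm_clip: "0 < B \<Longrightarrow> norm (clip B z) \<le> B"
  by (auto simp: clip_def norm_mult norm_divide max_def)

lemma clip_eq: "0 < B \<Longrightarrow> norm z \<le> B \<Longrightarrow> clip B z = z"
  by (simp add: clip_def max_absorb1)

lemma continuous_on_clip: "0 < B \<Longrightarrow> continuous_on A (clip B)"
  unfolding clip_def by (intro continuous_intros) (auto simp: max_def)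

lemma clip_borel: "0 < B \<Longrightarrow> clip B \<in> borel_measurable borel"
  by (intro borel_measurable_continuous_onI continuous_on_clip)

text \<open>
  A measurable function is an almost everywhere limit of continuous ones. Clipped at the bound of \<open>f\<close>,
  these converge to \<open>f\<close> in \<open>L\<^sup>p(0,1)\<close> by dominated convergence.
\<close>

lemma continuity_vectors_bounded:
  assumes p: "1 < p" and f[measurable]: "f \<in> borel_measurable borel" and B: "0 < B" "\<And>x. norm (f x) \<le> B"
  shows "abs_lfun f \<in> continuity_vectors p"
proof -
  have "f measurable_on {0<..<1}"
    by (subst measurable_on_iff_borel_measurable) (simp_all add: borel_in_unit_leb f)
  then obtain N g where N: "negligible N" and g: "\<And>n. continuous_on UNIV (g n :: real \<Rightarrow> complex)"
    and lim: "\<And>x. x \<notin> N \<Longrightarrow> (\<lambda>n. g n x) \<longlonglongrightarrow> (if x \<in> {0<..<1} then f x else 0)"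
    unfolding measurable_on_def by blast
  define u where "u n x = clip B (g n x)" for n x
  have u: "continuous_on UNIV (u n)" "norm (u n x) \<le> B" for n x
    unfolding u_def using B g by (auto intro!: norm_clip continuous_on_compose2[OF continuous_on_clip[of B UNIV]])
  have [measurable]: "u n \<in> borel_measurable borel" for n
    using u(1) by (rule borel_measurable_continuous_onI)
  show ?thesis
  proof (rule continuity_vectors_closed[OF p])
    show "abs_lfun (u n) \<in> continuity_vectors p" for n
      using p u by (rule continuity_vectors_continuous)
    show "abs_lfun f \<in> Lp p" using p f B(2) by (rule Lp_bounded)
    show "(\<lambda>n. Lp_norm p (abs_lfun (u n) - abs_lfun f)) \<longlonglongrightarrow> 0"
    proof (rule Lp_dominated_convergence[OF p])
      show "integrable unit_leb (\<lambda>x. (2 * B) powr p)" by (rule integrable_unit_leb_const)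
      show "norm (u n x - f x) \<le> 2 * B" for n x
        using norm_triangle_ineq4[of "u n x" "f x"] u(2)[of n x] B(2)[of x] by simp
      have "AE x in lebesgue. x \<notin> N"
        using N by (simp add: negligible_iff_null_sets AE_not_in)
      then have "AE x in unit_leb. x \<notin> N"
        by (subst AE_restrict_space_iff) (auto elim: AE_mp)
      moreover have "AE x in unit_leb. x \<in> {0<..<1}" by (rule AE_I2) simp
      ultimately show "AE x in unit_leb. (\<lambda>n. u n x) \<longlonglongrightarrow> f x"
      proof eventually_elim
        case (elim x)
        have "isCont (clip B) (f x)"
          using continuous_on_clip[OF B(1), of UNIV] by (simp add: continuous_on_eq_continuous_at)
        from isCont_tendsto_compose[OF this] lim[of x] elim
        show ?case using B by (simp add: u_def clip_eq)
      qed
    qed measurable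
  qed
qed

lemma strongly_continuous:
  assumes p: "1 < p" and F: "F \<in> Lp p"
  shows "((\<lambda>h. Lp_norm p (S_op h F - F)) \<longlongrightarrow> 0) (at_right 0)"
proof -
  obtain f where f[measurable]: "f \<in> borel_measurable borel" and Ff: "F = abs_lfun f"
    by (rule borel_representative)
  define u where "u n x = clip (real (Suc n)) (f x)" for n x
  have [measurable]: "u n \<in> borel_measurable borel" for n
    unfolding u_def by (rule measurable_compose[OF f clip_borel]) simp
  have "F \<in> continuity_vectors p"
  proof (rule continuity_vectors_closed[OF p])
    show "abs_lfun (u n) \<in> continuity_vectors p" for n
      by (rule continuity_vectors_bounded[OF p, of _ "real (Suc n)"]) (simp_all add: u_def norm_clip del: of_nat_Suc)
    show "(\<lambda>n. Lp_norm p (abs_lfun (u n) - F)) \<longlonglongrightarrow> 0"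
      unfolding Ff
    proof (rule Lp_dominated_convergence[OF p])
      have "integrable unit_leb (\<lambda>x. norm (f x) powr p)"
        using F by (simp add: Ff Lp_def p_integrable.abs_eq ae_rel_borel)
      then have "integrable unit_leb (\<lambda>x. 2 powr p * norm (f x) powr p)"
        by (rule integrable_mult_right)
      then show "integrable unit_leb (\<lambda>x. (2 * norm (f x)) powr p)"
        by (simp add: powr_mult)
      show "norm (u n x - f x) \<le> 2 * norm (f x)" for n x
      proof -
        have "real (Suc n) / max (real (Suc n)) (norm (f x)) \<le> 1" by (subst divide_le_eq_1) auto
        then have "norm (u n x) \<le> 1 * norm (f x)"
          unfolding u_def clip_def norm_mult norm_of_real by (intro mult_right_mono) auto
        then show ?thesis using norm_triangle_ineq4[of "u n x" "f x"] by simp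
      qed
      show "AE x in unit_leb. (\<lambda>n. u n x) \<longlonglongrightarrow> f x"
      proof (rule AE_I2, rule tendsto_eventually)
        fix x
        obtain n where "norm (f x) \<le> real n" using real_arch_simple by blast
        then have "u m x = f x" if "n \<le> m" for m
          using that unfolding u_def by (intro clip_eq) auto
        then show "\<forall>\<^sub>F n in sequentially. u n x = f x" by (auto simp: eventually_sequentially)
      qed
    qed measurable
  qed (fact F)
  then show ?thesis by (simp add: continuity_vectors_def)
qed

section \<open>Laplace transforms of orbits\<close>

text \<open>
  The Laplace transform at \<open>l\<close> of the orbit \<open>t \<mapsto> wcomp t f x\<close>, evaluated at each point \<open>x\<close>
  separately. It represents the resolvent at \<open>l\<close>.
\<close>

definition lap :: "real \<Rightarrow> (real \<Rightarrow> complex) \<Rightarrow> real \<Rightarrow> complex" where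
  "lap l f x = (LINT t|lborel. complex_of_real (indicator {0<..} t * exp (- l * t)) * wcomp t f x)"

lemma lap_borel [measurable]:
  assumes [measurable]: "f \<in> borel_measurable borel" shows "lap l f \<in> borel_measurable borel"
  unfolding lap_def[abs_def] by measurable

text \<open>
  On \<open>(0,x)\<close> the factor \<open>1 / (1 - s)\<close> is bounded by \<open>1 / (1 - x)\<close>, and \<open>\<bar>f\<bar> \<le> 1 + \<bar>f\<bar>\<^sup>p\<close> is integrable.
\<close>

lemma integrable_hardy_kernel:
  assumes p: "1 < p" and f[measurable]: "f \<in> borel_measurable borel" and F: "abs_lfun f \<in> Lp p"
    and x: "x \<in> {0<..<1}"
  shows "(\<lambda>s. f s / complex_of_real (1 - s)) absolutely_integrable_on {0<..<x}"
proof -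
  have "integrable unit_leb (\<lambda>s. norm (f s) powr p)"
    using F by (simp add: Lp_def p_integrable.abs_eq ae_rel_borel)
  then have "integrable unit_leb (\<lambda>s. (1 + norm (f s) powr p) / (1 - x))"
    by (intro integrable_divide_zero Bochner_Integration.integrable_add integrable_unit_leb_const)
  then have b: "(\<lambda>s. (1 + norm (f s) powr p) / (1 - x)) absolutely_integrable_on {0<..<1}"
    by (simp add: set_integrable_def integrable_restrict_space)
  have b: "(\<lambda>s. (1 + norm (f s) powr p) / (1 - x)) absolutely_integrable_on {0<..<x}"
    by (rule set_integrable_subset[OF b]) (use x in auto)
  have le: "norm (f s / complex_of_real (1 - s)) \<le> (1 + norm (f s) powr p) / (1 - x)" if s: "s \<in> {0<..<x}" for s
  proof -
    have "norm (f s) \<le> 1 + norm (f s) powr p"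
    proof (cases "norm (f s) \<le> 1")
      case False
      then have "norm (f s) powr 1 \<le> norm (f s) powr p" using p by (intro powr_mono) auto
      then show ?thesis using False by simp
    qed (simp add: add_increasing2)
    moreover have "norm (f s / complex_of_real (1 - s)) = norm (f s) / (1 - s)"
      using s x by (subst norm_divide, subst norm_of_real) auto
    ultimately show ?thesis using s x by (auto intro!: frac_le)
  qed
  show ?thesis
    unfolding set_integrable_def
  proof (rule Bochner_Integration.integrable_bound[OF b[unfolded set_integrable_def]])
    have "(\<lambda>s. indicator {0<..<x} s *\<^sub>R (f s / complex_of_real (1 - s))) \<in> borel_measurable borel"
      by measurable
    then show "(\<lambda>s. indicator {0<..<x} s *\<^sub>R (f s / complex_of_real (1 - s))) \<in> borel_measurable lebesgue"
      by (simp add: measurable_completion)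
    show "AE s in lebesgue. norm (indicator {0<..<x} s *\<^sub>R (f s / complex_of_real (1 - s)))
        \<le> norm (indicator {0<..<x} s *\<^sub>R ((1 + norm (f s) powr p) / (1 - x)))"
      using le by (intro AE_I2) (auto simp: indicator_def simp del: norm_divide of_real_diff abs_divide intro: order_trans[OF _ abs_ge_self])
  qed
qed

text \<open>
  For fixed \<open>x\<close>, the substitution \<open>s = phi t x\<close> maps \<open>(0,\<infinity>)\<close> onto \<open>(0,x)\<close> with
  \<open>ds = - s (1 - s) dt\<close>. The factor \<open>1 - s\<close> cancels the denominator of the kernel, and \<open>s / x\<close> remains
  as the weight of \<open>wcomp\<close>.
\<close>

lemma orbit_integral:
  assumes p: "1 < p" and f[measurable]: "f \<in> borel_measurable borel" and F: "abs_lfun f \<in> Lp p"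
    and x: "x \<in> {0<..<1}"
  shows "integrable lborel (\<lambda>t. complex_of_real (indicator {0<..} t) * wcomp t f x)"
    and "complex_of_real (1 / x) * (LINT s|lebesgue_on {0<..<x}. f s / complex_of_real (1 - s))
      = (LINT t|lborel. complex_of_real (indicator {0<..} t) * wcomp t f x)"
proof -
  define K where "K s = f s / complex_of_real (1 - s)" for s
  define g where "g t = \<bar>- (phi t x * (1 - phi t x))\<bar> *\<^sub>R K (phi t x)" for t
  have K: "K absolutely_integrable_on {0<..<x}"
    unfolding K_def using p f F x by (rule integrable_hardy_kernel)
  have g: "g t = complex_of_real x * wcomp t f x" for t
  proof -
    have "0 < phi t x" "phi t x < 1" using phi_in[OF x, of t] by auto
    then show ?thesis
      using x by (simp add: g_def K_def wcomp_def abs_mult scaleR_conv_of_real del: of_real_diff)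
  qed
  have "g absolutely_integrable_on {0<..} \<and> integral {0<..} g = integral {0<..<x} K"
    unfolding g_def using phi_deriv_time[OF x] inj_on_phi_time[OF x] K
    by (subst has_absolute_integral_change_of_variables_real) (auto simp: phi_time_image[OF x])
  then have gi: "g absolutely_integrable_on {0<..}" "integral {0<..} g = integral {0<..<x} K" by auto
  have gb: "(\<lambda>t. indicator {0<..} t *\<^sub>R g t) \<in> borel_measurable lborel"
    unfolding g by measurable
  have geq: "indicator {0<..} t *\<^sub>R g t = complex_of_real x * (complex_of_real (indicator {0<..} t) * wcomp t f x)" for t
    by (simp add: g scaleR_conv_of_real mult.left_commute)
  have int: "integrable lborel (\<lambda>t. indicator {0<..} t *\<^sub>R g t)"
    using gi(1) integrable_completion[OF gb] by (simp add: set_integrable_def)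
  then show "integrable lborel (\<lambda>t. complex_of_real (indicator {0<..} t) * wcomp t f x)"
    using integrable_mult_right[of "complex_of_real (1 / x)", OF int[unfolded geq]] x
    by (simp add: mult.assoc[symmetric])
  have "(LINT s|lebesgue_on {0<..<x}. K s) = integral {0<..<x} K"
    using set_lebesgue_integral_eq_integral(2)[OF K]
    by (simp add: set_lebesgue_integral_def integral_restrict_space)
  also have "\<dots> = (LINT t|lebesgue. indicator {0<..} t *\<^sub>R g t)"
    using set_lebesgue_integral_eq_integral(2)[OF gi(1)] gi(2) by (simp add: set_lebesgue_integral_def)
  also have "\<dots> = (LINT t|lborel. indicator {0<..} t *\<^sub>R g t)"
    by (rule integral_completion[OF gb])
  also have "\<dots> = complex_of_real x * (LINT t|lborel. complex_of_real (indicator {0<..} t) * wcomp t f x)"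
    unfolding geq by simp
  finally show "complex_of_real (1 / x) * (LINT s|lebesgue_on {0<..<x}. f s / complex_of_real (1 - s))
      = (LINT t|lborel. complex_of_real (indicator {0<..} t) * wcomp t f x)"
    using x by (simp add: K_def[abs_def])
qed

lemma C_op_eq_lap:
  assumes "1 < p" "f \<in> borel_measurable borel" "abs_lfun f \<in> Lp p"
  shows "C_op (abs_lfun f) = abs_lfun (lap 0 f)"
proof -
  let ?C = "\<lambda>x. complex_of_real (1 / x) * (LINT t|lebesgue_on {0<..<x}. f t / complex_of_real (1 - t))"
  have rel: "ae_rel ?C ?C"
    using C_op.rsp[unfolded rel_fun_def, rule_format, OF ae_rel_borel[OF assms(2)]] .
  have "ae_rel ?C (lap 0 f)"
    using rel assms orbit_integral(2)[OF assms]
    by (auto simp: ae_rel_def borel_in_unit_leb lap_def intro!: AE_I2)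
  then have "abs_lfun ?C = abs_lfun (lap 0 f)" by (rule Quotient_rel_abs[OF Quotient_lfun])
  then show ?thesis using assms(2) by (simp add: C_op.abs_eq ae_rel_borel)
qed

lemma lap_integrable:
  assumes p: "1 < p" and l: "0 \<le> l" and f[measurable]: "f \<in> borel_measurable borel"
    and F: "abs_lfun f \<in> Lp p" and x: "x \<in> {0<..<1}"
  shows "integrable lborel (\<lambda>t. complex_of_real (indicator {0<..} t * exp (- l * t)) * wcomp t f x)"
proof (rule Bochner_Integration.integrable_bound[OF orbit_integral(1)[OF p f F x]])
  show "AE t in lborel. norm (complex_of_real (indicator {0<..} t * exp (- l * t)) * wcomp t f x)
      \<le> norm (complex_of_real (indicator {0<..} t) * wcomp t f x)"
    using l by (intro AE_I2) (auto simp: norm_mult indicator_def intro!: mult_left_le_one_le)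
qed measurable

lemma pmass_leI:
  assumes "f \<in> borel_measurable borel" "0 < p" "abs_lfun f \<in> Lp p" "Lp_norm p (abs_lfun f) \<le> c"
  shows "pmass p f \<le> ennreal (c powr p)"
  using assms by (simp add: Lp_norm_powr ennreal_leI powr_mono2 Lp_norm_nonneg)

lemma nn_integral_exp:
  assumes "0 < w"
  shows "(\<integral>\<^sup>+t. ennreal (indicator {0<..} t * exp (- w * t)) \<partial>lborel) = ennreal (1 / w)"
proof -
  have "(\<integral>\<^sup>+t. ennreal (exp (- w * t)) * indicator {0..} t \<partial>lborel) = ennreal (0 - (- exp (- w * 0) / w))"
  proof (rule nn_integral_FTC_atLeast)
    show "DERIV (\<lambda>t. - exp (- w * t) / w) t :> exp (- w * t)" for t
      using assms by (auto intro!: derivative_eq_intros)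
    have "filterlim (\<lambda>t. - w * t) at_bot at_top"
      using assms by (intro filterlim_tendsto_neg_mult_at_bot[OF tendsto_const _ filterlim_ident]) auto
    from filterlim_compose[OF exp_at_bot this]
    have "((\<lambda>t. - exp (- w * t) / w) \<longlongrightarrow> - 0 / w) at_top"
      using assms by (intro tendsto_intros) auto
    then show "((\<lambda>t. - exp (- w * t) / w) \<longlongrightarrow> 0) at_top" by simp
  qed auto
  moreover have "(\<integral>\<^sup>+t. ennreal (indicator {0<..} t * exp (- w * t)) \<partial>lborel)
      = (\<integral>\<^sup>+t. ennreal (exp (- w * t)) * indicator {0..} t \<partial>lborel)"
    by (intro nn_integral_cong_AE, use AE_lborel_singleton[of 0] in eventually_elim)
      (auto simp: indicator_def)
  ultimately show ?thesis by simp
qed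

text \<open>
  The integrand is split as \<open>exp (- w t)\<close>, a density of total mass \<open>1 / w\<close>, times
  \<open>exp ((w - l) t) S\<^sub>t f\<close>, whose norm is at most that of \<open>f\<close> by the decay of \<open>S\<^sub>t\<close>.
\<close>

lemma lap_in_Lp:
  assumes p: "1 < p" and l: "0 \<le> l" and f[measurable]: "f \<in> borel_measurable borel" and F: "abs_lfun f \<in> Lp p"
  shows "abs_lfun (lap l f) \<in> Lp p"
proof -
  define w where "w = decay_rate p"
  have w: "w > 0" using decay_rate_pos[OF p] by (simp add: w_def)
  define N where "N = Lp_norm p (abs_lfun f)"
  have N: "0 \<le> N" by (simp add: N_def Lp_norm_nonneg)
  define G where "G t x = complex_of_real (exp ((w - l) * t)) * wcomp t f x" for t x
  define k where "k t = (indicator {0<..} t * exp (- w * t) :: real)" for t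
  have [measurable]: "k \<in> borel_measurable borel" "(\<lambda>(t, x). G t x) \<in> borel_measurable (borel \<Otimes>\<^sub>M borel)"
    unfolding k_def[abs_def] G_def by measurable
  have "pmass p (\<lambda>x. LINT t|lborel. complex_of_real (k t) * G t x) \<le> ennreal ((1 / w * N) powr p)"
  proof (rule pmass_integral_le[OF p])
    show "(\<integral>\<^sup>+t. ennreal (k t) \<partial>lborel) = ennreal (1 / w)"
      unfolding k_def by (rule nn_integral_exp[OF w])
    fix t assume "k t \<noteq> 0"
    then have t: "0 < t" by (auto simp: k_def indicator_def split: if_splits)
    have [measurable]: "wcomp t f \<in> borel_measurable borel" by measurable
    have eq: "abs_lfun (G t) = scale_lfun (of_real (exp ((w - l) * t))) (S_op t (abs_lfun f))"
      by (simp add: S_op_abs abs_lfun_scale G_def[abs_def])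
    have "Lp_norm p (abs_lfun (G t)) = exp ((w - l) * t) * Lp_norm p (S_op t (abs_lfun f))"
      unfolding eq using p by (subst Lp_norm_scale) auto
    also have "\<dots> \<le> exp ((w - l) * t) * (exp (- w * t) * N)"
      using S_op_bound(2)[OF p less_imp_le[OF t] F] by (intro mult_left_mono) (auto simp: w_def N_def)
    also have "\<dots> = exp (- (l * t)) * N"
      by (simp add: mult.assoc[symmetric] exp_add[symmetric] algebra_simps)
    also have "\<dots> \<le> 1 * N" using l t N by (intro mult_right_mono) auto
    finally have "Lp_norm p (abs_lfun (G t)) \<le> N" by simp
    moreover have "G t \<in> borel_measurable borel" unfolding G_def[abs_def] by measurable
    ultimately show "pmass p (G t) \<le> ennreal (N powr p)"
      using p t F by (intro pmass_leI) (auto simp: eq intro!: Lp_scale S_op_bound)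
  qed (use w N in \<open>simp_all add: k_def\<close>)
  moreover have "complex_of_real (k t) * G t x
      = complex_of_real (indicator {0<..} t * exp (- l * t)) * wcomp t f x" for t x
    by (simp add: k_def G_def exp_of_real[symmetric] exp_add[symmetric] algebra_simps)
  ultimately have "pmass p (lap l f) \<le> ennreal ((1 / w * N) powr p)"
    by (simp only: lap_def[abs_def])
  then show ?thesis
    using p w N by (intro Lp_boundI(1)) auto
qed

text \<open>
  The amount by which the integral of \<open>exp (- l t) S\<^sub>t f\<close> over \<open>(0,h)\<close> differs from \<open>h f\<close>.
\<close>

definition orbit_error :: "real \<Rightarrow> real \<Rightarrow> (real \<Rightarrow> complex) \<Rightarrow> real \<Rightarrow> complex" where
  "orbit_error l h f x = (LINT t|lborel. complex_of_real (indicator {0<..h} t) *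
     (complex_of_real (exp (- l * t)) * wcomp t f x - f x))"

lemma orbit_error_borel [measurable]:
  assumes [measurable]: "f \<in> borel_measurable borel" shows "orbit_error l h f \<in> borel_measurable borel"
  unfolding orbit_error_def[abs_def] by measurable

text \<open>
  Since \<open>S\<^sub>h S\<^sub>t = S\<^sub>h\<^sub>+\<^sub>t\<close>, translating the variable of integration by \<open>h\<close> shows that
  \<open>exp (- l h) S\<^sub>h (lap l f)\<close> is the part of the Laplace integral over \<open>(h,\<infinity>)\<close>.
\<close>

lemma lap_minus_shift:
  assumes p: "1 < p" and l: "0 \<le> l" and h: "0 < h" and f[measurable]: "f \<in> borel_measurable borel"
    and F: "abs_lfun f \<in> Lp p" and x: "x \<in> {0<..<1}"
  shows "lap l f x - complex_of_real (exp (- l * h)) * wcomp h (lap l f) x - complex_of_real h * f x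
    = orbit_error l h f x"
proof -
  define q where "q c t = complex_of_real (indicator {c<..} t * exp (- l * t)) * wcomp t f x" for c t :: real
  have q0: "integrable lborel (q 0)"
    unfolding q_def[abs_def] using p l f F x by (rule lap_integrable)
  have qh: "integrable lborel (q h)"
    by (rule Bochner_Integration.integrable_bound[OF q0])
      (use h in \<open>auto simp: q_def[abs_def] indicator_def norm_mult\<close>)
  have "complex_of_real (exp (- l * h)) * wcomp h (lap l f) x
      = (LINT t|lborel. complex_of_real (exp (- l * h)) * (complex_of_real (phi h x / x) *
          (complex_of_real (indicator {0<..} t * exp (- l * t)) * wcomp t f (phi h x))))"
    by (simp only: wcomp_def[of h] lap_def integral_mult_right_zero)
  also have "\<dots> = (LINT t|lborel. q h (h + 1 * t))"
  proof (rule Bochner_Integration.integral_cong[OF refl])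
    fix t :: real
    have "complex_of_real (phi h x / x) * wcomp t f (phi h x) = wcomp (h + t) f x"
      using wcomp_wcomp[OF x, of h t f] by (simp add: wcomp_def[of h])
    moreover have "exp (- l * (h + t)) = exp (- l * h) * exp (- l * t)"
      by (simp add: exp_add[symmetric] algebra_simps)
    moreover have "indicator {h<..} (h + t) = (indicator {0<..} t :: real)"
      by (simp add: indicator_def)
    moreover have "complex_of_real (exp (- l * h)) * (complex_of_real (phi h x / x) *
          (complex_of_real (indicator {0<..} t * exp (- l * t)) * wcomp t f (phi h x)))
        = complex_of_real (indicator {0<..} t * (exp (- l * h) * exp (- l * t))) *
          (complex_of_real (phi h x / x) * wcomp t f (phi h x))"
      by (simp only: of_real_mult mult_ac)
    ultimately show "complex_of_real (exp (- l * h)) * (complex_of_real (phi h x / x) *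
          (complex_of_real (indicator {0<..} t * exp (- l * t)) * wcomp t f (phi h x))) = q h (h + 1 * t)"
      by (simp only: q_def mult_1)
  qed
  also have "\<dots> = (LINT t|lborel. q h t)"
    using lborel_integral_real_affine[of 1 "q h" h] by simp
  finally have shift: "complex_of_real (exp (- l * h)) * wcomp h (lap l f) x = (LINT t|lborel. q h t)" .
  have c: "integrable lborel (\<lambda>t. complex_of_real (indicator {0<..h} t) * f x)"
    by (intro integrable_mult_left integrable_of_real integrable_real_indicator) (use h in auto)
  have "complex_of_real h * f x = (LINT t|lborel. complex_of_real (indicator {0<..h} t) * f x)"
    using h by simp
  then have "lap l f x - complex_of_real (exp (- l * h)) * wcomp h (lap l f) x - complex_of_real h * f x
      = (LINT t|lborel. q 0 t) - (LINT t|lborel. q h t) - (LINT t|lborel. complex_of_real (indicator {0<..h} t) * f x)"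
    by (simp only: shift) (simp only: lap_def q_def)
  also have "\<dots> = (LINT t|lborel. q 0 t - q h t - complex_of_real (indicator {0<..h} t) * f x)"
    using q0 qh c by simp
  also have "\<dots> = orbit_error l h f x"
    unfolding orbit_error_def using h
    by (intro Bochner_Integration.integral_cong) (auto simp: q_def indicator_def)
  finally show ?thesis .
qed

lemma orbit_error_bound:
  assumes p: "1 < p" and h: "0 < h" and c: "0 \<le> c" and f[measurable]: "f \<in> borel_measurable borel"
    and F: "abs_lfun f \<in> Lp p"
    and le: "\<And>t. 0 < t \<Longrightarrow> t \<le> h \<Longrightarrow>
      Lp_norm p (scale_lfun (of_real (exp (- l * t))) (S_op t (abs_lfun f)) - abs_lfun f) \<le> c"
  shows "abs_lfun (orbit_error l h f) \<in> Lp p" "Lp_norm p (abs_lfun (orbit_error l h f)) \<le> h * c"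
proof -
  define G where "G t x = complex_of_real (exp (- l * t)) * wcomp t f x - f x" for t x
  define k where "k t = (indicator {0<..h} t :: real)" for t
  have [measurable]: "k \<in> borel_measurable borel" "(\<lambda>(t, x). G t x) \<in> borel_measurable (borel \<Otimes>\<^sub>M borel)"
    unfolding k_def[abs_def] G_def by measurable
  have "pmass p (\<lambda>x. LINT t|lborel. complex_of_real (k t) * G t x) \<le> ennreal ((h * c) powr p)"
  proof (rule pmass_integral_le[OF p])
    show "(\<integral>\<^sup>+t. ennreal (k t) \<partial>lborel) = ennreal h"
      using h by (simp add: k_def ennreal_indicator)
    fix t assume "k t \<noteq> 0"
    then have t: "0 < t" "t \<le> h" by (auto simp: k_def indicator_def split: if_splits)
    have [measurable]: "wcomp t f \<in> borel_measurable borel" by measurable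
    have eq: "abs_lfun (G t) = scale_lfun (of_real (exp (- l * t))) (S_op t (abs_lfun f)) - abs_lfun f"
      by (simp add: S_op_abs abs_lfun_scale abs_lfun_diff G_def[abs_def])
    have "G t \<in> borel_measurable borel" unfolding G_def[abs_def] by measurable
    then show "pmass p (G t) \<le> ennreal (c powr p)"
      using p t F le[OF t] by (intro pmass_leI) (auto simp: eq intro!: Lp_scale S_op_bound Lp_diff)
  qed (use h c in \<open>simp_all add: k_def\<close>)
  then have "pmass p (orbit_error l h f) \<le> ennreal ((h * c) powr p)"
    by (simp only: orbit_error_def[abs_def] k_def G_def)
  then show "abs_lfun (orbit_error l h f) \<in> Lp p" "Lp_norm p (abs_lfun (orbit_error l h f)) \<le> h * c"
    using p h c by (auto intro!: Lp_boundI[where c = "h * c"])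
qed

text \<open>
  By strong continuity the orbit error is \<open>o(h)\<close>. So \<open>G - exp (- l h) S\<^sub>h G\<close> is \<open>h f + o(h)\<close>; multiplying by
  \<open>exp (l h) = 1 + l h + o(h)\<close> gives \<open>G - S\<^sub>h G = h (f - l G) + o(h)\<close>.
\<close>

lemma lap_generator:
  assumes p: "1 < p" and l: "0 \<le> l" and f[measurable]: "f \<in> borel_measurable borel"
    and F: "abs_lfun f \<in> Lp p"
  defines "G \<equiv> abs_lfun (lap l f)"
  shows "((\<lambda>h. Lp_norm p (G - S_op h G
      - scale_lfun (of_real h) (abs_lfun f - scale_lfun (of_real l) G)) / h) \<longlongrightarrow> 0) (at_right 0)"
proof -
  define N where "N = Lp_norm p"
  define D where "D h = abs_lfun (orbit_error l h f)" for h
  have G: "G \<in> Lp p" unfolding G_def using p l f F by (rule lap_in_Lp)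
  have small: "\<forall>\<^sub>F h in at_right 0. D h \<in> Lp p \<and> N (D h) \<le> h * e" if e: "e > 0" for e
  proof -
    have "((\<lambda>t. N (S_op t (abs_lfun f) - abs_lfun f) + (1 - exp (- l * t)) * N (abs_lfun f))
        \<longlongrightarrow> 0 + (1 - exp (- l * 0)) * N (abs_lfun f)) (at_right 0)"
      unfolding N_def by (intro tendsto_intros strongly_continuous p F)
    then have "\<forall>\<^sub>F t in at_right 0. N (S_op t (abs_lfun f) - abs_lfun f) + (1 - exp (- l * t)) * N (abs_lfun f) < e"
      using e by (auto dest: order_tendstoD(2))
    then obtain b where b: "0 < b"
        "\<And>t. 0 < t \<Longrightarrow> t < b \<Longrightarrow> N (S_op t (abs_lfun f) - abs_lfun f) + (1 - exp (- l * t)) * N (abs_lfun f) < e"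
      by (auto simp: eventually_at_right_field)
    have le: "N (scale_lfun (of_real (exp (- l * t))) (S_op t (abs_lfun f)) - abs_lfun f) \<le> e"
      if t: "0 < t" "t < b" for t
    proof -
      define r where "r = exp (- l * t)"
      have r: "0 \<le> r" "r \<le> 1" using l t by (auto simp: r_def)
      have SF: "S_op t (abs_lfun f) \<in> Lp p" using p t F by (simp add: S_op_bound)
      have "scale_lfun (of_real r) (S_op t (abs_lfun f)) - abs_lfun f
          = scale_lfun (of_real r) (S_op t (abs_lfun f) - abs_lfun f) + scale_lfun (of_real (r - 1)) (abs_lfun f)"
        by (simp add: lfun.scale_right_diff_distrib lfun.scale_left_diff_distrib)
      also have "N \<dots> \<le> N (scale_lfun (of_real r) (S_op t (abs_lfun f) - abs_lfun f)) + N (scale_lfun (of_real (r - 1)) (abs_lfun f))"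
        unfolding N_def using p SF F by (intro Lp_norm_triangle Lp_scale Lp_diff) auto
      also have "\<dots> = r * N (S_op t (abs_lfun f) - abs_lfun f) + (1 - r) * N (abs_lfun f)"
        unfolding N_def using p r by (simp add: Lp_norm_scale del: of_real_diff)
      also have "\<dots> \<le> 1 * N (S_op t (abs_lfun f) - abs_lfun f) + (1 - r) * N (abs_lfun f)"
        using r by (intro add_right_mono mult_right_mono) (simp_all add: N_def Lp_norm_nonneg)
      also have "\<dots> \<le> e" using b(2)[OF t] by (simp add: r_def)
      finally show ?thesis by (simp add: r_def)
    qed
    have "\<forall>\<^sub>F h in at_right 0. 0 < h \<and> h < b"
      using b(1) by (auto simp: eventually_at_right_field)
    then show ?thesis
    proof eventually_elim
      case (elim h)
      then show ?case
        using orbit_error_bound[OF p _ _ f F, of h e l] le e by (simp add: D_def N_def)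
    qed
  qed
  have Dlim: "((\<lambda>h. N (D h) / h) \<longlongrightarrow> 0) (at_right 0)"
  proof (rule tendstoI)
    fix e :: real assume e: "e > 0"
    then have "\<forall>\<^sub>F h in at_right 0. D h \<in> Lp p \<and> N (D h) \<le> h * (e / 2)" by (intro small) simp
    then show "\<forall>\<^sub>F h in at_right 0. dist (N (D h) / h) 0 < e"
      using eventually_at_right_less[of 0]
    proof eventually_elim
      case (elim h)
      then have "N (D h) / h \<le> e / 2" by (simp add: divide_le_eq mult.commute)
      moreover have "0 \<le> N (D h) / h" using elim by (simp add: N_def Lp_norm_nonneg)
      then have "dist (N (D h) / h) 0 = N (D h) / h" by (simp only: dist_real_def diff_0_right abs_of_nonneg)
      ultimately show ?case using e by linarith
    qed
  qed
  \<comment> \<open>The three terms of \<open>E\<close> bound the orbit error multiplied by \<open>exp (l h)\<close> and the errors of replacing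
    \<open>exp (l h) h f\<close> by \<open>h f\<close> and \<open>(exp (l h) - 1) G\<close> by \<open>h l G\<close>, each divided by \<open>h\<close>.\<close>
  define E where "E h = exp (l * h) * (N (D h) / h) + (exp (l * h) - 1) * N (abs_lfun f)
      + \<bar>l - (exp (l * h) - 1) / h\<bar> * N G" for h
  have "((\<lambda>h. exp (l * h)) has_real_derivative l) (at 0 within {0<..})"
    by (auto intro!: derivative_eq_intros)
  then have dexp: "((\<lambda>h. (exp (l * h) - 1) / h) \<longlongrightarrow> l) (at_right 0)"
    by (simp add: has_field_derivative_iff)
  have "(E \<longlongrightarrow> exp (l * 0) * 0 + (exp (l * 0) - 1) * N (abs_lfun f) + \<bar>l - l\<bar> * N G) (at_right 0)"
    unfolding E_def[abs_def] by (intro tendsto_intros Dlim dexp)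
  then have Elim: "(E \<longlongrightarrow> 0) (at_right 0)" by simp
  define T where "T h = G - S_op h G - scale_lfun (of_real h) (abs_lfun f - scale_lfun (of_real l) G)" for h
  have "((\<lambda>h. N (T h) / h) \<longlongrightarrow> 0) (at_right 0)"
  proof (rule tendsto_sandwich[OF _ _ tendsto_const Elim])
    show "\<forall>\<^sub>F h in at_right 0. 0 \<le> N (T h) / h"
      using eventually_at_right_less[of 0] by eventually_elim (simp add: N_def Lp_norm_nonneg)
    have "\<forall>\<^sub>F h in at_right 0. D h \<in> Lp p \<and> N (D h) \<le> h * 1" by (rule small) simp
    then show "\<forall>\<^sub>F h in at_right 0. N (T h) / h \<le> E h"
      using eventually_at_right_less[of 0]
    proof eventually_elim
      case (elim h)
      define r where "r = exp (l * h)"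
      have r: "r \<ge> 1" "exp (- l * h) = 1 / r" using l elim by (auto simp: r_def exp_minus field_simps)
      have "T h = (scale_lfun (of_real r) (D h) + scale_lfun (of_real ((r - 1) * h)) (abs_lfun f))
          + scale_lfun (of_real (h * l - (r - 1))) G"
      proof -
        have "T h = abs_lfun (\<lambda>x. lap l f x - wcomp h (lap l f) x - of_real h * (f x - of_real l * lap l f x))"
          by (simp add: T_def G_def S_op_abs abs_lfun_diff abs_lfun_scale)
        also have "\<dots> = abs_lfun (\<lambda>x. (of_real r * orbit_error l h f x + of_real ((r - 1) * h) * f x)
            + of_real (h * l - (r - 1)) * lap l f x)"
        proof (rule abs_lfun_eqI)
          fix x :: real assume x: "x \<in> {0<..<1}"
          have "orbit_error l h f x = lap l f x - complex_of_real (1 / r) * wcomp h (lap l f) x - complex_of_real h * f x"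
            using lap_minus_shift[OF p l _ f F x, of h] elim by (simp only: r(2))
          then have "of_real r * orbit_error l h f x
              = of_real r * lap l f x - wcomp h (lap l f) x - of_real (r * h) * f x"
            using r by (simp add: field_simps)
          then show "lap l f x - wcomp h (lap l f) x - of_real h * (f x - of_real l * lap l f x)
              = (of_real r * orbit_error l h f x + of_real ((r - 1) * h) * f x)
                + of_real (h * l - (r - 1)) * lap l f x"
            by (simp add: algebra_simps)
        qed measurable
        also have "\<dots> = (scale_lfun (of_real r) (D h) + scale_lfun (of_real ((r - 1) * h)) (abs_lfun f))
          + scale_lfun (of_real (h * l - (r - 1))) G"
          by (simp add: D_def G_def abs_lfun_add abs_lfun_scale)
        finally show ?thesis .
      qed
      also have "N \<dots> \<le> (N (scale_lfun (of_real r) (D h)) + N (scale_lfun (of_real ((r - 1) * h)) (abs_lfun f)))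
          + N (scale_lfun (of_real (h * l - (r - 1))) G)"
        unfolding N_def using p elim F G
        by (intro order_trans[OF Lp_norm_triangle] add_mono order_refl Lp_norm_triangle Lp_add Lp_scale) auto
      also have "\<dots> = r * N (D h) + ((r - 1) * h) * N (abs_lfun f) + \<bar>h * l - (r - 1)\<bar> * N G"
        unfolding N_def using p r elim by (simp add: Lp_norm_scale abs_mult del: of_real_diff of_real_mult)
      finally have "N (T h) / h \<le> (r * N (D h) + ((r - 1) * h) * N (abs_lfun f) + \<bar>h * l - (r - 1)\<bar> * N G) / h"
        using elim by (intro divide_right_mono) auto
      also have "\<dots> = E h"
      proof -
        have "\<bar>h * l - (r - 1)\<bar> = h * \<bar>l - (r - 1) / h\<bar>"
          using elim by (simp add: abs_mult_pos'[symmetric] field_simps flip: abs_mult_pos)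
        then show ?thesis using elim by (simp add: E_def r_def add_divide_distrib)
      qed
      finally show ?case .
    qed
  qed
  then show ?thesis by (simp add: N_def T_def)
qed

section \<open>Invariant subspaces of the integral operator\<close>

lemma resolvent_semigroup_Lp:
  assumes p: "1 < p"
  shows "resolvent_semigroup scale_lfun (Lp p) (Lp_norm p) S_op (decay_rate p)"
proof (unfold_locales, goal_cases)
  case 1 show ?case using p by (intro subspace_Lp) simp
next
  case (2 F G) then show ?case using p by (intro Lp_norm_triangle) auto
next
  case (3 c F) then show ?case using p by (intro Lp_norm_scale) auto
next
  case (4 F) then show ?case by (rule Lp_norm_nonneg)
next
  case (5 F) then show ?case by (simp add: Lp_norm_eq_0)
next
  case (6 t F G) then show ?case by (rule S_op_add)
next
  case (7 t c F) then show ?case by (rule S_op_scale)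
next
  case (8 F) then show ?case by (rule S_op_0)
next
  case (9 s t F) then show ?case by (simp add: S_op_S_op)
next
  case (10 t F) then show ?case using p by (simp add: S_op_bound)
next
  case 11 then show ?case using p by (rule decay_rate_pos)
next
  case (12 t F) then show ?case using p by (intro S_op_bound)
next
  case (13 l F)
  obtain f where f: "f \<in> borel_measurable borel" and Ff: "F = abs_lfun f"
    by (rule borel_representative)
  show ?case
    using 13 lap_generator[OF p _ f] lap_in_Lp[OF p _ f] by (auto simp: Ff)
qed

theorem theorem6p1:
  fixes p :: real and M :: "lfun set"
  assumes "1 < p"
    and "M \<subseteq> Lp p"
    and "lfun.subspace M"
    and "closedin (Lp_topology p) M"
  shows "C_op ` M \<subseteq> M \<longleftrightarrow> (\<forall>t\<ge>0. S_op t ` M \<subseteq> M)"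
proof -
  interpret Metric_space "Lp p" "Lp_dist p" using assms(1) by (intro Metric_space_Lp) simp
  interpret resolvent_semigroup scale_lfun "Lp p" "Lp_norm p" S_op "decay_rate p"
    by (rule resolvent_semigroup_Lp[OF assms(1)])
  interpret closed_subspace_of_semigroup scale_lfun "Lp p" "Lp_norm p" S_op "decay_rate p" M
  proof
    fix F :: "nat \<Rightarrow> lfun" and G
    assume F: "\<And>n. F n \<in> M" and G: "G \<in> Lp p" and lim: "(\<lambda>n. Lp_norm p (F n - G)) \<longlonglongrightarrow> 0"
    have "F n \<in> Lp p" for n using F assms(2) by blast
    then have "limitin mtopology F G sequentially"
      unfolding limitin_metric_dist_null using G lim by (simp add: Lp_dist_def)
    then show "G \<in> M"
      using assms(4) F unfolding metric_closedin_iff_sequentially_closed by blast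
  qed (use assms in auto)
  have "R 0 F = C_op F" if "F \<in> M" for F
  proof -
    obtain f where f: "f \<in> borel_measurable borel" and Ff: "F = abs_lfun f"
      by (rule borel_representative)
    have FX: "abs_lfun f \<in> Lp p" using that assms(2) Ff by auto
    show ?thesis
      unfolding Ff C_op_eq_lap[OF assms(1) f FX]
      using lap_generator[OF assms(1) _ f FX, of 0] lap_in_Lp[OF assms(1) _ f FX, of 0] FX
      by (intro R_eqI) (auto simp: neg_gen_def)
  qed
  then have "C_op ` M = R 0 ` M" by (intro image_cong) auto
  then show ?thesis using R_invariant_iff_S_invariant by simp
qed

end
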